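(* Let $\mu$ be a centered probability measure on $\mathbb{R}^d$ with finite second moments such that $\mathrm{Tr}(\mathrm{Cov}(\mu))\leq d$. Then $$\delta_{\mathrm{Tal}}(\mu)\;\geq\;\min\left(\frac{\mathrm{D}(\mu||\gamma)^2}{6d},\;\frac{\mathrm{D}(\mu||\gamma)}{4}\right).$$
   Context: $\gamma$ is the standard Gaussian measure on $\mathbb{R}^d$. The relative entropy of probability measures is $\mathrm{D}(\mu||\nu)=\int\ln\left(\frac{d\mu}{d\nu}\right)d\mu$, with value $+\infty$ if $\mu$ is not absolutely continuous with respect to $\nu$. The quadratic Wasserstein distance is $\mathcal{W}_2(\mu,\gamma)=\left(\inf_\pi\int_{\mathbb{R}^{2d}}\|x-y\|_2^2\,d\pi(x,y)\right)^{1/2}$, the infimum being over couplings $\pi$ of $\mu$ and $\gamma$. The deficit in Talagrand's inequality is $\delta_{\mathrm{Tal}}(\mu)=2\mathrm{D}(\mu||\gamma)-\mathcal{W}_2^2(\mu,\gamma)$ (equal to $+\infty$ if $\mathrm{D}(\mu||\gamma)=\infty$). $\mathrm{Cov}(\mu)$ is the covariance matrix of $\mu$. Centered means $\int x\,d\mu(x)=0$. *)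

theory Defs
  imports "HOL-Probability.Probability"
begin

definition std_gaussian :: "(real ^ 'n) measure" where
  "std_gaussian = density lborel (\<lambda>x. ennreal (\<Prod>i\<in>UNIV. std_normal_density (x $ i)))"

(* KL_divergence takes the reference measure first. It is a Bochner integral, hence 0 when
   the integrand is not integrable. For probability measures with mu << nu the negative part of
   ln (dmu/dnu) is always mu-integrable, so non-integrability means that the integral is
   +infinity. *)
definition relative_entropy :: "'a measure \<Rightarrow> 'a measure \<Rightarrow> ereal" where
  "relative_entropy \<mu> \<nu> =
     (if absolutely_continuous \<nu> \<mu> \<and> integrable \<mu> (entropy_density (exp 1) \<nu> \<mu>)
      then ereal (KL_divergence (exp 1) \<nu> \<mu>) else \<infinity>)"

definition couplings :: "'a measure \<Rightarrow> 'b measure \<Rightarrow> ('a \<times> 'b) measure set" where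
  "couplings \<mu> \<nu> = {\<pi>. sets \<pi> = sets (\<mu> \<Otimes>\<^sub>M \<nu>) \<and> distr \<pi> \<mu> fst = \<mu> \<and> distr \<pi> \<nu> snd = \<nu>}"

definition transport_cost2 :: "'a::real_normed_vector measure \<Rightarrow> 'a measure \<Rightarrow> ennreal" where
  "transport_cost2 \<mu> \<nu> =
     (INF \<pi>\<in>couplings \<mu> \<nu>. \<integral>\<^sup>+ p. ennreal ((norm (fst p - snd p))\<^sup>2) \<partial>\<pi>)"

definition wasserstein2 :: "'a::real_normed_vector measure \<Rightarrow> 'a measure \<Rightarrow> ereal" where
  "wasserstein2 \<mu> \<nu> =
     (if transport_cost2 \<mu> \<nu> = \<infinity> then \<infinity> else ereal (sqrt (enn2real (transport_cost2 \<mu> \<nu>))))"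

definition talagrand_deficit :: "(real ^ 'n) measure \<Rightarrow> ereal" where
  "talagrand_deficit \<mu> =
     (if relative_entropy \<mu> std_gaussian = \<infinity> then \<infinity>
      else 2 * relative_entropy \<mu> std_gaussian - (wasserstein2 \<mu> std_gaussian)\<^sup>2)"

definition covariance_matrix :: "(real ^ 'n) measure \<Rightarrow> real ^ 'n ^ 'n" where
  "covariance_matrix \<mu> =
     (let m = (\<integral>x. x \<partial>\<mu>) in \<chi> i j. \<integral>x. (x $ i - m $ i) * (x $ j - m $ j) \<partial>\<mu>)"

end

theory Submission
  imports Defs "HOL-Real_Asymp.Real_Asymp"
begin

text \<open>
  Write $\gamma$ for the standard Gaussian and $f$ for the Lebesgue density of $\mu$. The Knothe map
  $S$ from $\mu$ to $\gamma$ transports, coordinate by coordinate, the conditional law of $x_i$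
  given $x_1, \ldots, x_{i-1}$ monotonically to the standard normal law, so it only involves
  conditional distribution functions and the Gaussian quantile function. In one dimension
  $\varphi(S(x)) = E[S(X) 1_{X > x}]$ and Fubini give $E[X S(X)] = \int \varphi(S(x))\, dx$,
  which replaces the differentiation of $S$. Hence $E[X \cdot S(X)] \ge E \sum_i g_i$ with
  $g_i = \varphi(S_i) f_{i-1} / f_i$ for the marginal densities $f_i$, and the product
  $\prod_i g_i = \prod_i \varphi(S_i) / f$ telescopes. Bounding
  $g \ge l (1 - \ln l + \ln g)$ yields, for all $l > 0$, a transport cost of at most
  $(1 - l) E|X|^2 + d (1 - l) + 2 l d \ln l + 2 l D$. With $E|X|^2 \le d$, the choice
  $1 - l = \min (D / 2d, 1/2)$ gives the theorem.
\<close>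

section \<open>Atomless distributions on the line\<close>

text \<open>Formally g_i is the reciprocal of dS_i/dx_i, that is, the derivative of the inverse map
  T in its i-th coordinate. Then E[X S(X)] >= E[g] is Gaussian integration by parts, E[Z T(Z)] =
  E[T'(Z)], and the product identity is the change of variables formula for a triangular Jacobian.
  The obstacle is regularity: S need not be differentiable, supports may have gaps, slices may have
  mass zero. So g is defined as a quotient of densities, and only an inequality between integrals
  and an identity almost everywhere are proved about it. The inequality can be strict because a gap
  in the support contributes to the integral of phi(S) but not to E[g]. A map that is not optimal
  suffices, since any coupling bounds the Wasserstein distance from above. The tangent bound with a
  constant l, rather than the AM-GM inequality, leaves only E[ln prod g] to compute, which is an
  entropy. At l = 1 the result is Talagrand's inequality itself. Lowering l by s gains 2 s D and,
  because E|X|^2 <= d, loses only the second-order term 2 d s^2; this trade-off produces the two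
  regimes D^2/d and D.\<close>

locale atomless_distribution = cdf_distribution +
  assumes atomless: "measure M {x} = 0"
begin

lemma isCont_cdf_atomless: "isCont (cdf M) x"
  by (simp add: isCont_cdf atomless)

text \<open>The Galois connection \<open>pseudoinverse\<close> gives one inequality. The other is a
  limit from the left, where the absence of atoms rules out a jump.\<close>

lemma cdf_pseudoinverse:
  assumes "0 < u" "u < 1"
  shows "cdf M (Inf {x. u \<le> cdf M x}) = u"
proof (rule antisym)
  let ?q = "Inf {x. u \<le> cdf M x}"
  note q_le_iff = pseudoinverse[OF assms, symmetric]
  show "u \<le> cdf M ?q"
    using q_le_iff[of ?q] by blast
  have "(cdf M \<longlongrightarrow> cdf M ?q) (at_left ?q)"
    using isCont_cdf_atomless[of ?q] by (auto simp: isCont_def intro: tendsto_within_subset)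
  moreover have "eventually (\<lambda>s. cdf M s \<le> u) (at_left ?q)"
  proof -
    have "cdf M s \<le> u" if "s < ?q" for s
      using q_le_iff[of s] that by linarith
    then show ?thesis
      by (auto simp: eventually_at_filter)
  qed
  ultimately show "cdf M ?q \<le> u"
    by (intro tendsto_upperbound[of _ _ "at_left ?q"]) auto
qed

lemma prob_cdf_less:
  assumes "0 < u" "u < 1"
  shows "prob {x. cdf M x < u} = u"
proof -
  let ?q = "Inf {x. u \<le> cdf M x}"
  have "{x. cdf M x < u} = {..<?q}"
  proof (intro set_eqI)
    fix x show "x \<in> {x. cdf M x < u} \<longleftrightarrow> x \<in> {..<?q}"
      using pseudoinverse[OF assms, of x] by (simp only: mem_Collect_eq lessThan_iff not_le[symmetric])
  qed
  moreover have "prob {..<?q} = prob {..?q}"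
    using atomless[of ?q] by (subst ivl_disj_un_singleton(2)[symmetric], subst finite_measure_Union) auto
  ultimately show ?thesis
    using cdf_pseudoinverse[OF assms] by (simp add: cdf_def)
qed

text \<open>The cdf may be constant on an interval, so this is not immediate from the strict
  version. For every v > u the set lies in the one where the cdf is below v, and v decreases to
  u.\<close>

lemma prob_cdf_le:
  assumes "0 < u" "u < 1"
  shows "prob {x. cdf M x \<le> u} = u"
proof (rule antisym)
  show "prob {x. cdf M x \<le> u} \<le> u"
  proof (rule dense_ge_bounded[OF assms(2)])
    fix v assume v: "u < v" "v < 1"
    have "prob {x. cdf M x \<le> u} \<le> prob {x. cdf M x < v}"
      using v by (intro finite_measure_mono) auto
    with v assms show "prob {x. cdf M x \<le> u} \<le> v"
      by (simp add: prob_cdf_less)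
  qed
  have "prob {x. cdf M x < u} \<le> prob {x. cdf M x \<le> u}"
    by (intro finite_measure_mono) auto
  then show "u \<le> prob {x. cdf M x \<le> u}"
    using assms by (simp add: prob_cdf_less)
qed

text \<open>The same squeeze at the levels 0 and 1, which the preceding lemmas exclude. It confines
  the default value of the quantile function to a null set of \<open>M\<close>.\<close>

lemma AE_cdf_bounds: "AE x in M. 0 < cdf M x \<and> cdf M x < 1"
proof -
  have "prob {x. cdf M x \<le> 0} \<le> 0"
  proof (rule dense_ge_bounded[of 0 1])
    fix v :: real assume v: "0 < v" "v < 1"
    have "prob {x. cdf M x \<le> 0} \<le> prob {x. cdf M x < v}"
      using v by (intro finite_measure_mono) auto
    with v show "prob {x. cdf M x \<le> 0} \<le> v"
      by (simp add: prob_cdf_less)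
  qed simp
  then have 1: "AE x in M. \<not> cdf M x \<le> 0"
    by (intro AE_I[of _ _ "{x. cdf M x \<le> 0}"]) (auto simp: emeasure_eq_measure measure_le_0_iff)
  have "1 \<le> prob {x. cdf M x < 1}"
  proof (rule dense_le_bounded[of 0 1])
    fix v :: real assume v: "0 < v" "v < 1"
    have "prob {x. cdf M x < v} \<le> prob {x. cdf M x < 1}"
      using v by (intro finite_measure_mono) auto
    with v show "v \<le> prob {x. cdf M x < 1}"
      by (simp add: prob_cdf_less)
  qed simp
  then have "prob {x \<in> space M. cdf M x < 1} = 1"
    by (intro antisym) auto
  then have 2: "AE x in M. cdf M x < 1"
    by (subst (asm) prob_Collect_eq_1) auto
  from 1 2 show ?thesis
    by eventually_elim auto
qed

end

section \<open>The standard normal distribution function and its quantile function\<close>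

abbreviation std_normal_cdf :: "real \<Rightarrow> real" where
  "std_normal_cdf \<equiv> cdf std_normal_distribution"

interpretation std_normal: atomless_distribution std_normal_distribution
proof -
  interpret real_distribution std_normal_distribution
    by (rule real_dist_normal_dist)
  show "atomless_distribution std_normal_distribution"
  proof
    fix x
    have "emeasure std_normal_distribution {x} = 0"
      by (subst emeasure_density) (auto intro!: nn_integral_null_set)
    then show "measure std_normal_distribution {x} = 0"
      by (simp add: measure_def)
  qed
qed

text \<open>For u outside (0, 1) the set is the whole line or empty and \<open>Inf\<close> says
  nothing, hence the explicit default 0.\<close>

definition normal_quantile :: "real \<Rightarrow> real" where
  "normal_quantile u = (if 0 < u \<and> u < 1 then Inf {x. u \<le> std_normal_cdf x} else 0)"

lemma normal_quantile_le_iff: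
  assumes "0 < u" "u < 1"
  shows "normal_quantile u \<le> s \<longleftrightarrow> u \<le> std_normal_cdf s"
proof -
  have "normal_quantile u = Inf {x. u \<le> std_normal_cdf x}"
    using assms by (simp only: normal_quantile_def simp_thms if_True)
  then show ?thesis
    by (simp only: std_normal.pseudoinverse[OF assms, symmetric])
qed

lemma measurable_normal_quantile[measurable]: "normal_quantile \<in> borel_measurable borel"
proof -
  have "(\<lambda>u. if u \<in> {0<..<1} then Inf {x. u \<le> std_normal_cdf x} else 0) \<in> borel_measurable borel"
    by (subst measurable_If_restrict_space_iff) (use std_normal.measurable_CI in \<open>auto simp: greaterThanLessThan_eq[symmetric] greaterThanLessThan_def greaterThan_def lessThan_def Int_def\<close>)
  then show ?thesis
    by (simp add: normal_quantile_def[abs_def])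
qed

lemma std_normal_cdf_quantile:
  assumes "0 < u" "u < 1"
  shows "std_normal_cdf (normal_quantile u) = u"
proof -
  have "normal_quantile u = Inf {x. u \<le> std_normal_cdf x}"
    using assms by (simp only: normal_quantile_def simp_thms if_True)
  then show ?thesis
    using std_normal.cdf_pseudoinverse[OF assms] by (simp only:)
qed

lemma normal_quantile_mono:
  assumes "0 < u" "u \<le> v" "v < 1"
  shows "normal_quantile u \<le> normal_quantile v"
  using assms normal_quantile_le_iff[of u "normal_quantile v"] std_normal_cdf_quantile[of v] by linarith

lemma normal_quantile_strict_mono:
  assumes "0 < u" "u < v" "v < 1"
  shows "normal_quantile u < normal_quantile v"
  using assms normal_quantile_le_iff[of v "normal_quantile u"] std_normal_cdf_quantile[of u] by linarith

lemma std_normal_interval_pos: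
  assumes "a < b"
  shows "0 < measure std_normal_distribution {a<..b}"
proof -
  have "emeasure std_normal_distribution {a<..b} \<noteq> 0"
  proof
    assume "emeasure std_normal_distribution {a<..b} = 0"
    then have "AE x in lborel. ennreal (std_normal_density x) * indicator {a<..b} x = 0"
      by (subst (asm) emeasure_density) (auto simp: nn_integral_0_iff_AE)
    then have "AE x in lborel. x \<notin> {a<..b}"
      by eventually_elim (metis ennreal_eq_0_iff indicator_simps(1) mult.right_neutral normal_density_pos not_le zero_less_one)
    then have "emeasure lborel {a<..b} = 0"
      by (subst (asm) AE_iff_measurable[of "{a<..b}"]) auto
    with assms show False by simp
  qed
  then show ?thesis
    by (simp add: std_normal.emeasure_eq_measure zero_less_measure_iff)
qed

lemma std_normal_cdf_bounds: "0 < std_normal_cdf s" "std_normal_cdf s < 1"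
proof -
  have "0 < std_normal_cdf s - std_normal_cdf (s - 1)"
    using std_normal_interval_pos[of "s - 1" s] by (subst std_normal.cdf_diff_eq) auto
  then show "0 < std_normal_cdf s"
    using std_normal.cdf_nonneg[of "s - 1"] by linarith
  have "0 < std_normal_cdf (s + 1) - std_normal_cdf s"
    using std_normal_interval_pos[of s "s + 1"] by (subst std_normal.cdf_diff_eq) auto
  then show "std_normal_cdf s < 1"
    using std_normal.cdf_bounded_prob[of "s + 1"] by linarith
qed

lemma integrable_std_normal_id: "integrable std_normal_distribution (\<lambda>u. u)"
  using integrable_std_normal_distribution_moment[of 1] by simp

text \<open>The antiderivative of u phi(u) is - phi(u). This is the Gaussian ingredient of the
  integration by parts.\<close>

lemma std_normal_upper_tail_mean:
  "(\<integral>u. u * indicator {s<..} u \<partial>std_normal_distribution) = std_normal_density s"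
proof -
  have "(\<integral>u. u * indicator {s<..} u \<partial>std_normal_distribution)
      = (\<integral>u. std_normal_density u * (u * indicator {s<..} u) \<partial>lborel)"
    by (subst integral_density) (auto simp: normal_density_nonneg)
  also have "\<dots> = (LBINT u=ereal s..\<infinity>. std_normal_density u * u)"
    by (auto simp: interval_lebesgue_integral_def set_lebesgue_integral_def einterval_def
        intro!: Bochner_Integration.integral_cong split: split_indicator)
  also have "\<dots> = 0 - (- std_normal_density s)"
  proof (rule interval_integral_FTC_integrable)
    show "((\<lambda>u. - std_normal_density u) has_vector_derivative std_normal_density x * x) (at x)" for x
      unfolding std_normal_density_def has_real_derivative_iff_has_vector_derivative[symmetric]
      by (auto intro!: derivative_eq_intros simp: field_simps)
    show "isCont (\<lambda>u. std_normal_density u * u) x" for x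
      unfolding std_normal_density_def by (intro continuous_intros) auto
    show "set_integrable lborel (einterval (ereal s) \<infinity>) (\<lambda>u. std_normal_density u * u)"
      unfolding set_integrable_def
      using integrable_std_normal_moment[of 1] by (intro integrable_mult_indicator) auto
    show "(((\<lambda>u. - std_normal_density u) \<circ> real_of_ereal) \<longlongrightarrow> - std_normal_density s) (at_right (ereal s))"
      unfolding ereal_tendsto_simps std_normal_density_def by (intro tendsto_intros) auto
    have "((\<lambda>u. - std_normal_density u) \<longlongrightarrow> 0) at_top"
      unfolding std_normal_density_def by real_asymp
    then show "(((\<lambda>u. - std_normal_density u) \<circ> real_of_ereal) \<longlongrightarrow> 0) (at_left \<infinity>)"
      unfolding ereal_tendsto_simps .
  qed auto
  finally show ?thesis by simp
qed

section \<open>The monotone map to the standard normal distribution\<close>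

context atomless_distribution
begin

definition gaussian_map :: "real \<Rightarrow> real" where
  "gaussian_map x = normal_quantile (cdf M x)"

lemma measurable_gaussian_map[measurable]: "gaussian_map \<in> borel_measurable borel"
  unfolding gaussian_map_def[abs_def] by measurable

lemma distr_gaussian_map: "distr M borel gaussian_map = std_normal_distribution"
proof (rule cdf_unique)
  show "real_distribution (distr M borel gaussian_map)"
    by (rule real_distribution_distr) simp
  show "real_distribution std_normal_distribution"
    by (rule real_dist_normal_dist)
  show "cdf (distr M borel gaussian_map) = std_normal_cdf"
  proof
    fix s
    have "cdf (distr M borel gaussian_map) s = prob {x. gaussian_map x \<le> s}"
      by (simp add: cdf_def measure_distr vimage_def atMost_def)
    also have "\<dots> = prob {x. cdf M x \<le> std_normal_cdf s}"
    proof (rule finite_measure_eq_AE)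
      show "AE x in M. (x \<in> {x. gaussian_map x \<le> s}) = (x \<in> {x. cdf M x \<le> std_normal_cdf s})"
        using AE_cdf_bounds
        by eventually_elim (simp only: mem_Collect_eq gaussian_map_def normal_quantile_le_iff)
    qed auto
    also have "\<dots> = std_normal_cdf s"
      by (rule prob_cdf_le[OF std_normal_cdf_bounds])
    finally show "cdf (distr M borel gaussian_map) s = std_normal_cdf s" .
  qed
qed

lemma integrable_gaussian_map_compose:
  fixes h :: "real \<Rightarrow> real"
  assumes [measurable]: "h \<in> borel_measurable borel" and "integrable std_normal_distribution h"
  shows "integrable M (\<lambda>x. h (gaussian_map x))"
  using assms(2) unfolding distr_gaussian_map[symmetric] by (subst (asm) integrable_distr_eq) auto

lemma expectation_gaussian_map_compose:
  fixes h :: "real \<Rightarrow> real"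
  assumes [measurable]: "h \<in> borel_measurable borel"
  shows "expectation (\<lambda>x. h (gaussian_map x)) = integral\<^sup>L std_normal_distribution h"
  unfolding distr_gaussian_map[symmetric] by (subst integral_distr) auto

lemma nn_integral_gaussian_map_compose:
  assumes [measurable]: "h \<in> borel_measurable borel"
  shows "(\<integral>\<^sup>+x. h (gaussian_map x) \<partial>M) = integral\<^sup>N std_normal_distribution h"
  unfolding distr_gaussian_map[symmetric] by (subst nn_integral_distr) auto

lemma integrable_gaussian_map: "integrable M gaussian_map"
  by (rule integrable_gaussian_map_compose[OF _ integrable_std_normal_id]) simp

lemma expectation_gaussian_map: "expectation gaussian_map = 0"
proof -
  have "expectation (\<lambda>x. gaussian_map x) = (\<integral>u. u \<partial>std_normal_distribution)"
    by (rule expectation_gaussian_map_compose) simp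
  also have "\<dots> = 0"
    using integral_std_normal_distribution_moment_odd[of 1] by (simp only: power_one_right odd_one simp_thms)
  finally show ?thesis .
qed

text \<open>Up to a null set, y lies above x exactly when its image lies above that of x: an
  exception would be a point \<open>y\<close> to the right of \<open>x\<close> where the cdf has not
  grown, and the set \<open>?D\<close> of these has mass F(x) - F(x) = 0. The tail mean can
  therefore be computed on the Gaussian side.\<close>

lemma gaussian_map_upper_tail_mean:
  assumes "0 < cdf M x" "cdf M x < 1"
  shows "expectation (\<lambda>y. gaussian_map y * indicator {x<..} y) = std_normal_density (gaussian_map x)"
proof -
  let ?D = "{y. cdf M y \<le> cdf M x} - {..x}"
  have "prob ?D = prob {y. cdf M y \<le> cdf M x} - prob {..x}"
    by (rule finite_measure_Diff) (auto intro: cdf_nondecreasing)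
  also have "\<dots> = 0"
    using prob_cdf_le[OF assms] by (simp add: cdf_def)
  finally have "AE y in M. y \<notin> ?D"
    by (intro AE_I[of _ _ ?D]) (auto simp: emeasure_eq_measure)
  then have "AE y in M. x < y \<longleftrightarrow> gaussian_map x < gaussian_map y"
    using AE_cdf_bounds
  proof eventually_elim
    case (elim y)
    show ?case
    proof
      assume "x < y"
      then have "cdf M x < cdf M y"
        using elim by auto
      then show "gaussian_map x < gaussian_map y"
        using elim assms by (auto simp: gaussian_map_def intro: normal_quantile_strict_mono)
    next
      assume *: "gaussian_map x < gaussian_map y"
      show "x < y"
      proof (rule ccontr)
        assume "\<not> x < y"
        then have "cdf M y \<le> cdf M x"
          by (intro cdf_nondecreasing) auto
        then have "gaussian_map y \<le> gaussian_map x"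
          using elim assms by (auto simp: gaussian_map_def intro: normal_quantile_mono)
        with * show False by simp
      qed
    qed
  qed
  then have "expectation (\<lambda>y. gaussian_map y * indicator {x<..} y)
      = expectation (\<lambda>y. gaussian_map y * indicator {gaussian_map x<..} (gaussian_map y))"
    by (intro integral_cong_AE) (auto simp: indicator_def)
  also have "\<dots> = std_normal_density (gaussian_map x)"
    using expectation_gaussian_map_compose[of "\<lambda>u. u * indicator {gaussian_map x<..} u"]
    by (simp add: std_normal_upper_tail_mean)
  finally show ?thesis .
qed

text \<open>Gaussian integration by parts without derivatives: writing y as an integral over x and
  exchanging the integrals leaves upper tail means, which are known. The indicator matters because
  \<open>gaussian_map\<close> takes the default 0 where the cdf is 0 or 1, and there phi(0) > 0
  would be integrated over half-lines.\<close>

lemma expectation_mult_gaussian_map_ge: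
  assumes sq: "integrable M (\<lambda>x. x\<^sup>2)"
  shows "integrable M (\<lambda>x. x * gaussian_map x)"
    and "(\<integral>\<^sup>+x. ennreal (std_normal_density (gaussian_map x)) *
            indicator {x. 0 < cdf M x \<and> cdf M x < 1} x \<partial>lborel)
        \<le> ennreal (expectation (\<lambda>x. x * gaussian_map x))"
    and "0 \<le> expectation (\<lambda>x. x * gaussian_map x)"
proof -
  \<comment> \<open>A kernel with \<open>\<integral>k x y dx = y\<close>; since \<open>gaussian_map\<close> has mean zero, integrating it against
    \<open>k x\<close> gives the upper tail mean for \<open>x\<close> of either sign.\<close>
  define k :: "real \<Rightarrow> real \<Rightarrow> real" where
    "k x y = indicator {0..<y} x - indicator {y..<0} x" for x y
  have G2: "integrable M (\<lambda>x. (gaussian_map x)\<^sup>2)"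
    using integrable_gaussian_map_compose[of "\<lambda>u. u^2"] integrable_std_normal_distribution_moment[of 2]
    by simp
  show int: "integrable M (\<lambda>x. x * gaussian_map x)"
  proof (rule Bochner_Integration.integrable_bound[OF Bochner_Integration.integrable_add[OF sq G2]])
    show "AE x in M. norm (x * gaussian_map x) \<le> norm (x\<^sup>2 + (gaussian_map x)\<^sup>2)"
    proof (rule AE_I2)
      fix x
      have "2 * \<bar>x\<bar> * \<bar>gaussian_map x\<bar> \<le> \<bar>x\<bar>\<^sup>2 + \<bar>gaussian_map x\<bar>\<^sup>2"
        by (rule sum_squares_bound)
      moreover have "0 \<le> \<bar>x\<bar> * \<bar>gaussian_map x\<bar>" by simp
      ultimately show "norm (x * gaussian_map x) \<le> norm (x\<^sup>2 + (gaussian_map x)\<^sup>2)"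
        unfolding real_norm_def abs_mult abs_of_nonneg[OF sum_power2_ge_zero] power2_abs by linarith
    qed
  qed simp
  interpret Q: pair_sigma_finite M lborel ..
  have k_meas[measurable]: "(\<lambda>(x, y). k x y) \<in> borel_measurable (borel \<Otimes>\<^sub>M borel)"
    unfolding k_def indicator_def atLeastLessThan_iff by measurable
  have ind_int: "integrable lborel (\<lambda>x. indicator {a..<b} x :: real)" for a b :: real
    by (intro integrable_real_indicator emeasure_bounded_finite) auto
  have k_int: "integrable lborel (\<lambda>x. k x y)" for y
    unfolding k_def by (intro Bochner_Integration.integrable_diff ind_int)
  have k_integral: "(\<integral>x. k x y \<partial>lborel) = y" for y
    unfolding k_def by (subst Bochner_Integration.integral_diff[OF ind_int ind_int]) (cases "0 \<le> y"; simp)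
  have k_abs: "(\<integral>x. \<bar>k x y\<bar> \<partial>lborel) = \<bar>y\<bar>" for y
  proof -
    have "\<bar>k x y\<bar> = indicator {0..<y} x + indicator {y..<0} x" for x
      by (auto simp: k_def indicator_def)
    then show ?thesis
      by (simp add: Bochner_Integration.integral_add[OF ind_int ind_int]) (cases "0 \<le> y"; simp)
  qed
  have fub: "integrable (M \<Otimes>\<^sub>M lborel) (\<lambda>(y, x). gaussian_map y * k x y)"
  proof (rule Q.Fubini_integrable)
    show "integrable M (\<lambda>y. \<integral>x. norm (case (y, x) of (y, x) \<Rightarrow> gaussian_map y * k x y) \<partial>lborel)"
      using integrable_abs[OF int] by (simp add: abs_mult k_abs mult.commute)
  qed (auto intro: k_int)
  define H where "H x = expectation (\<lambda>y. gaussian_map y * k x y)" for x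
  have H_eq: "H x = expectation (\<lambda>y. gaussian_map y * indicator {x<..} y)" for x
  proof (cases "0 \<le> x")
    case True
    then show ?thesis
      unfolding H_def k_def by (intro Bochner_Integration.integral_cong) (auto simp: indicator_def)
  next
    case False
    then have "H x = expectation (\<lambda>y. gaussian_map y * indicator {x<..} y - gaussian_map y)"
      unfolding H_def k_def by (intro Bochner_Integration.integral_cong) (auto simp: indicator_def)
    also have "\<dots> = expectation (\<lambda>y. gaussian_map y * indicator {x<..} y) - expectation gaussian_map"
      by (intro Bochner_Integration.integral_diff integrable_real_mult_indicator integrable_gaussian_map) auto
    finally show ?thesis
      by (simp add: expectation_gaussian_map)
  qed
  have H_int: "integrable lborel H" and H_integral: "(\<integral>x. H x \<partial>lborel) = expectation (\<lambda>x. x * gaussian_map x)"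
  proof -
    show "integrable lborel H"
      using Q.integrable_snd[OF fub] by (simp add: H_def[abs_def])
    have "(\<integral>x. H x \<partial>lborel) = (\<integral>y. (\<integral>x. gaussian_map y * k x y \<partial>lborel) \<partial>M)"
      unfolding H_def using Q.Fubini_integral[OF fub] by simp
    also have "\<dots> = expectation (\<lambda>x. x * gaussian_map x)"
      by (simp add: k_integral mult.commute)
    finally show "(\<integral>x. H x \<partial>lborel) = expectation (\<lambda>x. x * gaussian_map x)" .
  qed
  have H_ge: "std_normal_density (gaussian_map x) * indicator {x. 0 < cdf M x \<and> cdf M x < 1} x \<le> H x" for x
  proof -
    consider "0 < cdf M x \<and> cdf M x < 1" | "cdf M x = 0" | "cdf M x = 1"
      using cdf_nonneg[of x] cdf_bounded_prob[of x] by linarith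
    then show ?thesis
    proof cases
      case 1
      then show ?thesis by (simp add: H_eq gaussian_map_upper_tail_mean)
    next
      case 2
      then have "AE y in M. y \<notin> {..x}"
        by (intro AE_I[of _ _ "{..x}"]) (auto simp: cdf_def emeasure_eq_measure)
      then have "H x = expectation gaussian_map"
        unfolding H_eq by (intro integral_cong_AE) (auto simp: indicator_def)
      with 2 show ?thesis by (simp add: expectation_gaussian_map)
    next
      case 3
      then have "prob {y \<in> space M. y \<in> {..x}} = 1"
        by (simp add: cdf_def atMost_def)
      then have "AE y in M. y \<in> {..x}"
        by (subst (asm) prob_Collect_eq_1) auto
      then have "H x = expectation (\<lambda>_. 0)"
        unfolding H_eq by (intro integral_cong_AE) (auto simp: indicator_def)
      with 3 show ?thesis by simp
    qed
  qed
  have H_nonneg: "0 \<le> H x" for x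
    using H_ge[of x] by (rule order_trans[rotated]) (simp add: normal_density_nonneg)
  show "0 \<le> expectation (\<lambda>x. x * gaussian_map x)"
    unfolding H_integral[symmetric] using H_nonneg by (intro Bochner_Integration.integral_nonneg)
  have "(\<integral>\<^sup>+x. ennreal (std_normal_density (gaussian_map x)) *
            indicator {x. 0 < cdf M x \<and> cdf M x < 1} x \<partial>lborel) \<le> (\<integral>\<^sup>+x. ennreal (H x) \<partial>lborel)"
  proof (rule nn_integral_mono)
    fix x show "ennreal (std_normal_density (gaussian_map x)) *
        indicator {x. 0 < cdf M x \<and> cdf M x < 1} x \<le> ennreal (H x)"
      using H_ge[of x] by (cases "0 < cdf M x \<and> cdf M x < 1") (auto intro!: ennreal_leI)
  qed
  also have "\<dots> = ennreal (expectation (\<lambda>x. x * gaussian_map x))"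
    using H_int H_nonneg by (subst nn_integral_eq_integral) (auto simp: H_integral)
  finally show "(\<integral>\<^sup>+x. ennreal (std_normal_density (gaussian_map x)) *
            indicator {x. 0 < cdf M x \<and> cdf M x < 1} x \<partial>lborel)
        \<le> ennreal (expectation (\<lambda>x. x * gaussian_map x))" .
qed

text \<open>The square is expanded and the cross term moved to the left; the 1 is the second moment
  of the image law. If the law has infinite second moment, the right side is infinite.\<close>

lemma gaussian_map_cost:
  "(\<integral>\<^sup>+x. ennreal ((x - gaussian_map x)\<^sup>2) \<partial>M)
    + 2 * (\<integral>\<^sup>+x. ennreal (std_normal_density (gaussian_map x)) *
            indicator {x. 0 < cdf M x \<and> cdf M x < 1} x \<partial>lborel)
    \<le> (\<integral>\<^sup>+x. ennreal (x\<^sup>2) \<partial>M) + 1"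
proof (cases "(\<integral>\<^sup>+x. ennreal (x\<^sup>2) \<partial>M) = \<infinity>")
  case False
  then have sq: "integrable M (\<lambda>x. x\<^sup>2)"
    by (intro integrableI_bounded) (auto simp: less_top)
  note mult_int = expectation_mult_gaussian_map_ge(1)[OF sq]
  have nonneg: "0 \<le> expectation (\<lambda>x. x * gaussian_map x)"
    by (rule expectation_mult_gaussian_map_ge(3)[OF sq])
  have G2: "integrable M (\<lambda>x. (gaussian_map x)\<^sup>2)"
    using integrable_gaussian_map_compose[of "\<lambda>u. u^2"] integrable_std_normal_distribution_moment[of 2]
    by simp
  have G2_eq: "expectation (\<lambda>x. (gaussian_map x)\<^sup>2) = 1"
    using expectation_gaussian_map_compose[of "\<lambda>u. u^2"] std_normal_distribution_even_moments(1)[of 1]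
    by simp
  have eq: "(x - gaussian_map x)\<^sup>2 = x\<^sup>2 + (gaussian_map x)\<^sup>2 - 2 * (x * gaussian_map x)" for x
    by (simp add: power2_diff)
  have int: "integrable M (\<lambda>x. (x - gaussian_map x)\<^sup>2)"
    unfolding eq using sq G2 mult_int by auto
  have "expectation (\<lambda>x. (x - gaussian_map x)\<^sup>2)
      = expectation (\<lambda>x. x\<^sup>2) + 1 - 2 * expectation (\<lambda>x. x * gaussian_map x)"
    unfolding eq using sq G2 mult_int G2_eq by simp
  then have "ennreal (expectation (\<lambda>x. (x - gaussian_map x)\<^sup>2) + 2 * expectation (\<lambda>x. x * gaussian_map x))
     = ennreal (expectation (\<lambda>x. x\<^sup>2) + 1)"
    by simp
  then have "ennreal (expectation (\<lambda>x. (x - gaussian_map x)\<^sup>2)) + 2 * ennreal (expectation (\<lambda>x. x * gaussian_map x))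
     = ennreal (expectation (\<lambda>x. x\<^sup>2)) + 1"
    using nonneg by (subst (asm) (1 2) ennreal_plus) (auto simp: ennreal_mult)
  moreover have "(\<integral>\<^sup>+x. ennreal ((x - gaussian_map x)\<^sup>2) \<partial>M) = ennreal (expectation (\<lambda>x. (x - gaussian_map x)\<^sup>2))"
    using int by (intro nn_integral_eq_integral) auto
  moreover have "(\<integral>\<^sup>+x. ennreal (x\<^sup>2) \<partial>M) = ennreal (expectation (\<lambda>x. x\<^sup>2))"
    using sq by (intro nn_integral_eq_integral) auto
  moreover note add_left_mono[OF mult_left_mono[OF expectation_mult_gaussian_map_ge(2)[OF sq] zero_le[of 2]],
    of "\<integral>\<^sup>+x. ennreal ((x - gaussian_map x)\<^sup>2) \<partial>M"]
  ultimately show ?thesis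
    by (simp only:)
qed simp

end

section \<open>The monotone map of an unnormalized density\<close>

text \<open>The Knothe construction applies the monotone map to every slice of a density. With the
  normalization inside, it is one total function of the slice, so joint measurability in the slice
  and the point can be checked directly. A slice of mass 0 or infinity gives the quotient 0 and
  hence the constant map 0.\<close>

definition density_gaussian_map :: "(real \<Rightarrow> ennreal) \<Rightarrow> real \<Rightarrow> real" where
  "density_gaussian_map f t = normal_quantile
     (enn2real ((\<integral>\<^sup>+s. f s * indicator {..t} s \<partial>lborel) / (\<integral>\<^sup>+s. f s \<partial>lborel)))"

context
  fixes f :: "real \<Rightarrow> ennreal" and m :: ennreal
  assumes f[measurable]: "f \<in> borel_measurable borel"
    and m: "m = (\<integral>\<^sup>+s. f s \<partial>lborel)" "0 < m" "m < \<infinity>"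
begin

private abbreviation "\<nu> \<equiv> density lborel (\<lambda>t. f t / m)"

private lemma mult_div: "m * (c / m) = c"
  using m by (simp add: ennreal_times_divide mult.commute ennreal_mult_divide_eq)

private lemma nn_integral_\<nu>:
  assumes [measurable]: "h \<in> borel_measurable borel"
  shows "m * (\<integral>\<^sup>+t. h t \<partial>\<nu>) = (\<integral>\<^sup>+t. f t * h t \<partial>lborel)"
  by (simp add: nn_integral_density nn_integral_cmult[symmetric] mult.assoc[symmetric] mult_div)

private lemma atomless_\<nu>: "atomless_distribution \<nu>"
proof -
  interpret prob_space \<nu>
  proof
    have "emeasure \<nu> UNIV = (\<integral>\<^sup>+t. f t \<partial>lborel) / m"
      by (simp add: emeasure_density nn_integral_divide)
    then show "emeasure \<nu> (space \<nu>) = 1"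
      using m(2,3) unfolding m(1)[symmetric] by simp
  qed
  interpret real_distribution \<nu>
    by standard auto
  show ?thesis
  proof
    fix x
    have "emeasure \<nu> {x} = 0"
      by (subst emeasure_density) (auto intro!: nn_integral_null_set)
    then show "measure \<nu> {x} = 0"
      by (simp add: measure_def)
  qed
qed

interpretation atomless_distribution \<nu>
  by (rule atomless_\<nu>)

private lemma gaussian_map_eq: "density_gaussian_map f = gaussian_map"
proof
  fix t
  have "emeasure \<nu> {..t} = (\<integral>\<^sup>+s. f s * indicator {..t} s / m \<partial>lborel)"
    by (subst emeasure_density) (auto simp: divide_ennreal_def ac_simps)
  also have "\<dots> = (\<integral>\<^sup>+s. f s * indicator {..t} s \<partial>lborel) / m"
    by (rule nn_integral_divide) simp
  finally have "emeasure \<nu> {..t} = (\<integral>\<^sup>+s. f s * indicator {..t} s \<partial>lborel) / m" .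
  then show "density_gaussian_map f t = gaussian_map t"
    unfolding density_gaussian_map_def gaussian_map_def cdf_def measure_def m(1)[symmetric] by simp
qed

private lemma push_pos:
  assumes [measurable]: "h \<in> borel_measurable borel"
  shows "(\<integral>\<^sup>+t. f t * h (density_gaussian_map f t) \<partial>lborel)
    = m * (\<integral>\<^sup>+u. ennreal (std_normal_density u) * h u \<partial>lborel)"
proof -
  have "(\<integral>\<^sup>+t. f t * h (gaussian_map t) \<partial>lborel) = m * (\<integral>\<^sup>+t. h (gaussian_map t) \<partial>\<nu>)"
    by (rule nn_integral_\<nu>[symmetric]) simp
  also have "\<dots> = m * (\<integral>\<^sup>+u. ennreal (std_normal_density u) * h u \<partial>lborel)"
    by (subst nn_integral_gaussian_map_compose) (simp_all add: nn_integral_density)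
  finally show ?thesis
    by (simp add: gaussian_map_eq)
qed

text \<open>This is \<open>gaussian_map_cost\<close> for the normalized law, multiplied by
  \<open>m\<close>. The factor \<open>m / f t\<close> is the reciprocal of the normalized density,
  and \<open>f t\<close> times it is at most \<open>m\<close>: equal to \<open>m\<close> where
  \<open>f t\<close> is positive and finite, and 0 elsewhere.\<close>

private lemma cost_pos:
  "(\<integral>\<^sup>+t. f t * (ennreal ((t - density_gaussian_map f t)\<^sup>2)
      + 2 * ennreal (std_normal_density (density_gaussian_map f t) * enn2real (m / f t))) \<partial>lborel)
   \<le> (\<integral>\<^sup>+t. f t * ennreal (t\<^sup>2) \<partial>lborel) + m"
proof -
  let ?A = "{x. 0 < cdf \<nu> x \<and> cdf \<nu> x < 1}"
  let ?g = "\<lambda>t. ennreal (std_normal_density (gaussian_map t) * enn2real (m / f t))"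
  \<comment> \<open>A statement almost everywhere for the normalized law becomes one for Lebesgue
    measure where the density is positive; it permits inserting the indicator of
    \<open>?A\<close>.\<close>
  have A: "AE t in lborel. 0 < f t \<longrightarrow> t \<in> ?A"
  proof -
    have "AE t in lborel. 0 < f t / m \<longrightarrow> t \<in> ?A"
      using AE_cdf_bounds by (subst (asm) AE_density) auto
    then show ?thesis
      by (rule AE_mp, intro AE_I2) (use m in \<open>auto simp: ennreal_zero_less_divide\<close>)
  qed
  have fm: "f t * ennreal (enn2real (m / f t)) \<le> m" for t
  proof (cases "f t = 0 \<or> f t = \<infinity>")
    case False
    then have "m / f t < \<infinity>"
      using m by (simp add: ennreal_divide_eq_top_iff less_top[symmetric])
    then have "f t * ennreal (enn2real (m / f t)) = f t * (m / f t)"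
      by simp
    also have "\<dots> = m"
      using False by (simp add: ennreal_times_divide mult.commute ennreal_mult_divide_eq)
    finally show ?thesis by simp
  qed auto
  have "(\<integral>\<^sup>+t. f t * ?g t \<partial>lborel)
      \<le> (\<integral>\<^sup>+t. m * (ennreal (std_normal_density (gaussian_map t)) * indicator ?A t) \<partial>lborel)"
  proof (rule nn_integral_mono_AE)
    show "AE t in lborel. f t * ?g t \<le> m * (ennreal (std_normal_density (gaussian_map t)) * indicator ?A t)"
      using A
    proof eventually_elim
      case (elim t)
      have "f t * ?g t = (f t * ennreal (enn2real (m / f t))) * ennreal (std_normal_density (gaussian_map t))"
        by (simp add: ennreal_mult normal_density_nonneg ac_simps)
      also have "\<dots> \<le> m * ennreal (std_normal_density (gaussian_map t))"
        by (intro mult_right_mono fm) simp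
      finally show ?case
        using elim by (cases "f t = 0") (auto simp: zero_less_iff_neq_zero)
    qed
  qed
  also have "\<dots> = m * (\<integral>\<^sup>+t. ennreal (std_normal_density (gaussian_map t)) * indicator ?A t \<partial>lborel)"
    by (rule nn_integral_cmult) simp
  finally have g: "(\<integral>\<^sup>+t. f t * ?g t \<partial>lborel) \<le> \<dots>" .
  have "(\<integral>\<^sup>+t. f t * (ennreal ((t - gaussian_map t)\<^sup>2) + 2 * ?g t) \<partial>lborel)
      = (\<integral>\<^sup>+t. f t * ennreal ((t - gaussian_map t)\<^sup>2) \<partial>lborel) + 2 * (\<integral>\<^sup>+t. f t * ?g t \<partial>lborel)"
  proof -
    have eq: "f t * (a + 2 * b) = f t * a + 2 * (f t * b)" for a b t
      by (simp only: distrib_left mult.left_commute)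
    show ?thesis
      unfolding eq by (simp add: nn_integral_add nn_integral_cmult)
  qed
  also have "\<dots> \<le> m * (\<integral>\<^sup>+t. ennreal ((t - gaussian_map t)\<^sup>2) \<partial>\<nu>)
      + 2 * (m * (\<integral>\<^sup>+t. ennreal (std_normal_density (gaussian_map t)) * indicator ?A t \<partial>lborel))"
    by (intro add_mono mult_left_mono g) (simp_all add: nn_integral_\<nu>)
  also have "\<dots> = m * ((\<integral>\<^sup>+t. ennreal ((t - gaussian_map t)\<^sup>2) \<partial>\<nu>)
      + 2 * (\<integral>\<^sup>+t. ennreal (std_normal_density (gaussian_map t)) * indicator ?A t \<partial>lborel))"
    by (simp add: distrib_left mult.left_commute)
  also have "\<dots> \<le> m * ((\<integral>\<^sup>+t. ennreal (t\<^sup>2) \<partial>\<nu>) + 1)"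
    by (intro mult_left_mono gaussian_map_cost) simp
  also have "\<dots> = (\<integral>\<^sup>+t. f t * ennreal (t\<^sup>2) \<partial>lborel) + m"
    by (simp add: distrib_left nn_integral_\<nu>)
  finally show ?thesis
    by (simp add: gaussian_map_eq)
qed

lemmas density_gaussian_map_pos = push_pos cost_pos

end

lemma nn_integral_mult_AE_zero:
  assumes "AE x in M. f x = 0"
  shows "(\<integral>\<^sup>+x. f x * g x \<partial>M) = 0"
proof -
  have "AE x in M. f x * g x = 0"
    using assms by eventually_elim simp
  from nn_integral_cong_AE[OF this] show ?thesis by simp
qed

text \<open>Mass zero has to be covered because slices of a joint density may vanish; both sides are
  then 0.\<close>

lemma nn_integral_density_gaussian_map:
  assumes f[measurable]: "f \<in> borel_measurable borel" and h[measurable]: "h \<in> borel_measurable borel"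
    and m: "(\<integral>\<^sup>+s. f s \<partial>lborel) < \<infinity>"
  shows "(\<integral>\<^sup>+t. f t * h (density_gaussian_map f t) \<partial>lborel)
    = (\<integral>\<^sup>+s. f s \<partial>lborel) * (\<integral>\<^sup>+u. ennreal (std_normal_density u) * h u \<partial>lborel)"
proof (cases "(\<integral>\<^sup>+s. f s \<partial>lborel) = 0")
  case True
  then have "AE t in lborel. f t = 0"
    by (simp add: nn_integral_0_iff_AE)
  with True show ?thesis
    by (simp add: nn_integral_mult_AE_zero)
next
  case False
  then show ?thesis
    using m by (intro density_gaussian_map_pos(1)) (auto simp: zero_less_iff_neq_zero)
qed

lemma density_gaussian_map_cost:
  assumes f[measurable]: "f \<in> borel_measurable borel"
    and m: "m = (\<integral>\<^sup>+s. f s \<partial>lborel)" "m < \<infinity>"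
  shows "(\<integral>\<^sup>+t. f t * (ennreal ((t - density_gaussian_map f t)\<^sup>2)
      + 2 * ennreal (std_normal_density (density_gaussian_map f t) * enn2real (m / f t))) \<partial>lborel)
   \<le> (\<integral>\<^sup>+t. f t * ennreal (t\<^sup>2) \<partial>lborel) + m"
proof (cases "m = 0")
  case True
  then have "AE t in lborel. f t = 0"
    using m by (simp add: nn_integral_0_iff_AE)
  then show ?thesis
    by (simp add: nn_integral_mult_AE_zero)
next
  case False
  then show ?thesis
    using m by (intro density_gaussian_map_pos(2)) (auto simp: zero_less_iff_neq_zero)
qed

section \<open>The Knothe map\<close>

text \<open>Tonelli for the indicator of the exceptional set: if almost all of its sections are
  null, so is the set.\<close>

lemma (in product_sigma_finite) AE_PiM_insert:
  assumes "finite I" "i \<notin> I"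
    and P[measurable]: "Measurable.pred (Pi\<^sub>M (insert i I) M) P"
    and AE: "AE x in Pi\<^sub>M I M. AE y in M i. P (x(i := y))"
  shows "AE x in Pi\<^sub>M (insert i I) M. P x"
proof -
  have "(\<integral>\<^sup>+x. indicator {x \<in> space (Pi\<^sub>M (insert i I) M). \<not> P x} x \<partial>Pi\<^sub>M (insert i I) M)
      = (\<integral>\<^sup>+x. (\<integral>\<^sup>+y. indicator {x \<in> space (Pi\<^sub>M (insert i I) M). \<not> P x} (x(i := y)) \<partial>M i) \<partial>Pi\<^sub>M I M)"
    by (rule product_nn_integral_insert[OF assms(1,2)]) measurable
  also have "\<dots> = (\<integral>\<^sup>+x. 0 \<partial>Pi\<^sub>M I M)"
  proof (rule nn_integral_cong_AE)
    show "AE x in Pi\<^sub>M I M. (\<integral>\<^sup>+y. indicator {x \<in> space (Pi\<^sub>M (insert i I) M). \<not> P x} (x(i := y)) \<partial>M i) = 0"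
      using AE
    proof eventually_elim
      case (elim x)
      have "(\<integral>\<^sup>+y. indicator {x \<in> space (Pi\<^sub>M (insert i I) M). \<not> P x} (x(i := y)) \<partial>M i) = (\<integral>\<^sup>+y. 0 \<partial>M i)"
        by (rule nn_integral_cong_AE, use elim in eventually_elim, simp)
      then show ?case by simp
    qed
  qed
  finally have "emeasure (Pi\<^sub>M (insert i I) M) {x \<in> space (Pi\<^sub>M (insert i I) M). \<not> P x} = 0"
    by simp
  then show ?thesis
    by (subst AE_iff_measurable[OF _ refl]) auto
qed

interpretation lborel_prod: product_sigma_finite "\<lambda>_. lborel :: real measure"
  by standard

text \<open>
  Here \<open>g j\<close> is the $j$-th factor $\varphi(S_j) f_{j-1} / f_j$ of the telescoping product. Expanding
  the square in the cost bound, it says that $E[g_j] \le E[x_j S_j]$; in this form every integrand is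
  nonnegative, and no integrability has to be carried through the induction.
\<close>

lemma knothe_map_exists:
  fixes f :: "('i \<Rightarrow> real) \<Rightarrow> ennreal"
  assumes "finite I"
    and "f \<in> borel_measurable (Pi\<^sub>M I (\<lambda>_. lborel))"
    and "(\<integral>\<^sup>+z. f z \<partial>Pi\<^sub>M I (\<lambda>_. lborel)) = 1"
  shows "\<exists>S g. S \<in> measurable (Pi\<^sub>M I (\<lambda>_. lborel)) (Pi\<^sub>M I (\<lambda>_. lborel)) \<and>
    (\<forall>j\<in>I. g j \<in> borel_measurable (Pi\<^sub>M I (\<lambda>_. lborel))) \<and> (\<forall>j z. 0 \<le> g j z) \<and>
    (\<forall>h\<in>borel_measurable (Pi\<^sub>M I (\<lambda>_. lborel)).
      (\<integral>\<^sup>+z. f z * h (S z) \<partial>Pi\<^sub>M I (\<lambda>_. lborel))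
      = (\<integral>\<^sup>+z. (\<Prod>j\<in>I. ennreal (std_normal_density (z j))) * h z \<partial>Pi\<^sub>M I (\<lambda>_. lborel))) \<and>
    (\<forall>j\<in>I. (\<integral>\<^sup>+z. f z * (ennreal ((z j - S z j)\<^sup>2) + 2 * ennreal (g j z)) \<partial>Pi\<^sub>M I (\<lambda>_. lborel))
      \<le> (\<integral>\<^sup>+z. f z * ennreal ((z j)\<^sup>2) \<partial>Pi\<^sub>M I (\<lambda>_. lborel)) + 1) \<and>
    (AE z in Pi\<^sub>M I (\<lambda>_. lborel). 0 < f z \<longrightarrow>
      (\<Prod>j\<in>I. g j z) * enn2real (f z) = (\<Prod>j\<in>I. std_normal_density (S z j)))"
  using assms
proof (induction I arbitrary: f rule: finite_induct)
  case empty
  \<comment> \<open>The product over no coordinates is a point mass, so total mass 1 determines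
    \<open>f\<close>, and the product identity reduces to 1 = 1.\<close>
  have "f (\<lambda>_. undefined) = 1"
    using empty by (simp add: PiM_empty nn_integral_count_space_finite)
  then show ?case
    by (intro exI[of _ "\<lambda>z. z"] exI[of _ "\<lambda>_ _. 0"]) (auto simp: PiM_empty nn_integral_count_space_finite AE_count_space)
next
  case (insert i I)
  let ?L = "Pi\<^sub>M I (\<lambda>_. lborel) :: ('i \<Rightarrow> real) measure"
  let ?L' = "Pi\<^sub>M (insert i I) (\<lambda>_. lborel) :: ('i \<Rightarrow> real) measure"
  note f[measurable] = insert.prems(1)
  note nn_insert = lborel_prod.product_nn_integral_insert[OF insert.hyps]
  have upd[measurable]: "(\<lambda>p. (fst p)(i := snd p)) \<in> measurable (?L \<Otimes>\<^sub>M lborel) ?L'"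
    using measurable_add_dim[of i I "\<lambda>_. lborel"] by (simp add: split_beta')
  have upd'[measurable]: "(\<lambda>p. (fst p)(i := snd p)) \<in> measurable (?L' \<Otimes>\<^sub>M lborel) ?L'"
    using measurable_add_dim[of i "insert i I" "\<lambda>_. lborel"] by (simp add: split_beta')
  have upd1: "(\<lambda>t. z(i := t)) \<in> measurable borel ?L'" if "z \<in> space ?L" for z
    using measurable_component_update[OF that insert.hyps(2)] by simp
  have restr[measurable]: "(\<lambda>z. restrict z I) \<in> measurable ?L' ?L"
    by (rule measurable_restrict_subset) auto
  have restr_upd: "restrict (x(i := t)) I = x" if "x \<in> space ?L" for x t
    using that insert.hyps(2) by (auto simp: space_PiM PiE_def extensional_def restrict_def fun_eq_iff)
  have restr_id: "restrict x I = x" if "x \<in> space ?L" for x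
    using that by (simp add: space_PiM PiE_restrict)
  \<comment> \<open>The marginal density of the old coordinates, to which the induction hypothesis
    applies. The new coordinate \<open>i\<close> comes last in the triangular order and is
    transported conditionally on all the others.\<close>
  define f' where "f' x = (\<integral>\<^sup>+t. f (x(i := t)) \<partial>lborel)" for x
  have f'[measurable]: "f' \<in> borel_measurable ?L"
    unfolding f'_def by measurable
  have f''[measurable]: "f' \<in> borel_measurable ?L'"
    unfolding f'_def by measurable
  have f'_upd: "f' (x(i := t)) = f' x" for x t
    by (simp add: f'_def)
  have f'_1: "(\<integral>\<^sup>+x. f' x \<partial>?L) = 1"
    unfolding f'_def using trans[OF nn_insert[OF f, symmetric] insert.prems(2)] .
  have f'_fin: "AE x in ?L. f' x < \<infinity>"
    using nn_integral_noteq_infinite[OF f'] f'_1 by (auto simp: less_top)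
  obtain S' g' where S'[measurable]: "S' \<in> measurable ?L ?L"
    and g'[measurable]: "\<And>j. j \<in> I \<Longrightarrow> g' j \<in> borel_measurable ?L" and g'_nonneg: "\<And>j z. 0 \<le> g' j z"
    and push': "\<And>h. h \<in> borel_measurable ?L \<Longrightarrow> (\<integral>\<^sup>+z. f' z * h (S' z) \<partial>?L)
        = (\<integral>\<^sup>+z. (\<Prod>j\<in>I. ennreal (std_normal_density (z j))) * h z \<partial>?L)"
    and cost': "\<And>j. j \<in> I \<Longrightarrow> (\<integral>\<^sup>+z. f' z * (ennreal ((z j - S' z j)\<^sup>2) + 2 * ennreal (g' j z)) \<partial>?L)
        \<le> (\<integral>\<^sup>+z. f' z * ennreal ((z j)\<^sup>2) \<partial>?L) + 1"
    and prod': "AE z in ?L. 0 < f' z \<longrightarrow>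
        (\<Prod>j\<in>I. g' j z) * enn2real (f' z) = (\<Prod>j\<in>I. std_normal_density (S' z j))"
    using insert.IH[OF f' f'_1] by (elim exE conjE) (rule that, blast+)
  define s where "s z = density_gaussian_map (\<lambda>t. f (z(i := t))) (z i)" for z
  define S where "S z = (S' (restrict z I))(i := s z)" for z
  \<comment> \<open>The quotient is the reciprocal of the conditional density of coordinate
    \<open>i\<close>; its numerator is what cancels against the product for the old
    coordinates.\<close>
  define g where "g j z = (if j = i then std_normal_density (s z) * enn2real (f' z / f z)
      else g' j (restrict z I))" for j z
  have [measurable]: "(\<lambda>z. z i) \<in> borel_measurable ?L'"
    by measurable
  have s[measurable]: "s \<in> borel_measurable ?L'"
  proof -
    have "(\<lambda>z. \<integral>\<^sup>+t. f (z(i := t)) * indicator {..z i} t \<partial>lborel) \<in> borel_measurable ?L'"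
      unfolding indicator_def atMost_iff by measurable
    then show ?thesis
      unfolding s_def density_gaussian_map_def f'_def[symmetric] by measurable
  qed
  have S_meas: "S \<in> measurable ?L' ?L'"
  proof -
    have "(\<lambda>z. (S' (restrict z I), s z)) \<in> measurable ?L' (?L \<Otimes>\<^sub>M lborel)"
      by measurable
    from measurable_compose[OF this upd] show ?thesis
      by (simp add: S_def[abs_def])
  qed
  have g_meas: "g j \<in> borel_measurable ?L'" if "j \<in> insert i I" for j
  proof (cases "j = i")
    case True
    then show ?thesis unfolding g_def[abs_def] by simp
  next
    case False
    with that have [measurable]: "g' j \<in> borel_measurable ?L" by (auto intro: g')
    from False show ?thesis unfolding g_def[abs_def] by simp
  qed
  have g_nonneg: "0 \<le> g j z" for j z
    by (simp add: g_def g'_nonneg normal_density_nonneg)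
  have f_upd[measurable]: "(\<lambda>t. f (x(i := t))) \<in> borel_measurable borel" if "x \<in> space ?L" for x
    using measurable_compose[OF upd1[OF that] f] .
  have s_upd: "s (x(i := t)) = density_gaussian_map (\<lambda>t. f (x(i := t))) t" for x t
    by (simp add: s_def)
  have S_upd: "S (x(i := t)) = (S' x)(i := density_gaussian_map (\<lambda>t. f (x(i := t))) t)"
    if "x \<in> space ?L" for x t
    using that by (simp add: S_def restr_upd s_upd)
  have push: "(\<integral>\<^sup>+z. f z * h (S z) \<partial>?L')
      = (\<integral>\<^sup>+z. (\<Prod>j\<in>insert i I. ennreal (std_normal_density (z j))) * h z \<partial>?L')"
    if h[measurable]: "h \<in> borel_measurable ?L'" for h
  proof -
    note [measurable] = S_meas
    have dens: "(\<lambda>z. ennreal (std_normal_density (z j))) \<in> borel_measurable ?L'" if "j \<in> insert i I" for j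
      using measurable_compose[OF measurable_component_singleton[OF that, of "\<lambda>_. lborel"],
          of "\<lambda>x. ennreal (std_normal_density x)" borel] by simp
    \<comment> \<open>Integrating out the last coordinate of a slice replaces its image by an
      independent normal variable, so the induction hypothesis is needed for this average of
      \<open>h\<close>.\<close>
    define h' where "h' y = (\<integral>\<^sup>+u. ennreal (std_normal_density u) * h (y(i := u)) \<partial>lborel)" for y
    have [measurable]: "h' \<in> borel_measurable ?L"
      unfolding h'_def by measurable
    have "(\<integral>\<^sup>+z. f z * h (S z) \<partial>?L') = (\<integral>\<^sup>+x. (\<integral>\<^sup>+t. f (x(i := t)) * h (S (x(i := t))) \<partial>lborel) \<partial>?L)"
      by (rule nn_insert) simp
    also have "\<dots> = (\<integral>\<^sup>+x. f' x * h' (S' x) \<partial>?L)"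
    proof (rule nn_integral_cong_AE)
      show "AE x in ?L. (\<integral>\<^sup>+t. f (x(i := t)) * h (S (x(i := t))) \<partial>lborel) = f' x * h' (S' x)"
        using f'_fin AE_space
      proof eventually_elim
        case (elim x)
        then have "S' x \<in> space ?L"
          using measurable_space[OF S'] by auto
        from measurable_compose[OF upd1[OF this] h]
        show ?case
          using nn_integral_density_gaussian_map[OF f_upd[OF elim(2)], of "\<lambda>u. h ((S' x)(i := u))"] elim
          by (simp add: S_upd f'_def h'_def)
      qed
    qed
    also have "\<dots> = (\<integral>\<^sup>+y. (\<Prod>j\<in>I. ennreal (std_normal_density (y j))) * h' y \<partial>?L)"
      by (rule push') simp
    also have "\<dots> = (\<integral>\<^sup>+y. (\<integral>\<^sup>+u. (\<Prod>j\<in>insert i I. ennreal (std_normal_density ((y(i := u)) j))) * h (y(i := u)) \<partial>lborel) \<partial>?L)"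
    proof (rule nn_integral_cong)
      fix y assume y: "y \<in> space ?L"
      have [measurable]: "(\<lambda>u. h (y(i := u))) \<in> borel_measurable borel"
        using measurable_compose[OF upd1[OF y] h] .
      have "(\<Prod>j\<in>I. ennreal (std_normal_density ((y(i := u)) j))) = (\<Prod>j\<in>I. ennreal (std_normal_density (y j)))" for u
        using insert.hyps by (intro prod.cong) auto
      then have "(\<Prod>j\<in>insert i I. ennreal (std_normal_density ((y(i := u)) j))) * h (y(i := u))
          = (\<Prod>j\<in>I. ennreal (std_normal_density (y j))) * (ennreal (std_normal_density u) * h (y(i := u)))" for u
        using insert.hyps by (simp add: ac_simps)
      then show "(\<Prod>j\<in>I. ennreal (std_normal_density (y j))) * h' y
         = (\<integral>\<^sup>+u. (\<Prod>j\<in>insert i I. ennreal (std_normal_density ((y(i := u)) j))) * h (y(i := u)) \<partial>lborel)"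
        by (simp only: h'_def) (rule nn_integral_cmult[symmetric], simp)
    qed
    also have "\<dots> = (\<integral>\<^sup>+z. (\<Prod>j\<in>insert i I. ennreal (std_normal_density (z j))) * h z \<partial>?L')"
      by (rule nn_insert[symmetric])
        (intro borel_measurable_times_ennreal borel_measurable_prod_ennreal h dens)
    finally show ?thesis .
  qed
  have cost: "(\<integral>\<^sup>+z. f z * (ennreal ((z j - S z j)\<^sup>2) + 2 * ennreal (g j z)) \<partial>?L')
      \<le> (\<integral>\<^sup>+z. f z * ennreal ((z j)\<^sup>2) \<partial>?L') + 1" if j: "j \<in> insert i I" for j
  proof (cases "j = i")
    case True
    note [measurable] = S_meas g_meas[of i, simplified]
    have "(\<lambda>z. S z i) = s"
      by (simp add: S_def fun_eq_iff)
    then have [measurable]: "(\<lambda>z. S z i) \<in> borel_measurable ?L'"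
      by simp
    have "(\<integral>\<^sup>+z. f z * (ennreal ((z i - S z i)\<^sup>2) + 2 * ennreal (g i z)) \<partial>?L')
        = (\<integral>\<^sup>+x. (\<integral>\<^sup>+t. f (x(i := t)) * (ennreal (((x(i := t)) i - S (x(i := t)) i)\<^sup>2) + 2 * ennreal (g i (x(i := t)))) \<partial>lborel) \<partial>?L)"
      by (rule nn_insert) simp
    also have "\<dots> \<le> (\<integral>\<^sup>+x. (\<integral>\<^sup>+t. f (x(i := t)) * ennreal (t\<^sup>2) \<partial>lborel) + f' x \<partial>?L)"
    proof (rule nn_integral_mono_AE)
      show "AE x in ?L. (\<integral>\<^sup>+t. f (x(i := t)) * (ennreal (((x(i := t)) i - S (x(i := t)) i)\<^sup>2) + 2 * ennreal (g i (x(i := t)))) \<partial>lborel)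
          \<le> (\<integral>\<^sup>+t. f (x(i := t)) * ennreal (t\<^sup>2) \<partial>lborel) + f' x"
        using f'_fin AE_space
      proof eventually_elim
        case (elim x)
        show ?case
          using density_gaussian_map_cost[OF f_upd[OF elim(2)] f'_def elim(1)] elim(2)
          by (simp add: S_upd g_def s_upd f'_upd)
      qed
    qed
    also have "\<dots> = (\<integral>\<^sup>+x. (\<integral>\<^sup>+t. f (x(i := t)) * ennreal (t\<^sup>2) \<partial>lborel) \<partial>?L) + 1"
      by (simp add: nn_integral_add f'_1)
    also have "(\<integral>\<^sup>+x. (\<integral>\<^sup>+t. f (x(i := t)) * ennreal (t\<^sup>2) \<partial>lborel) \<partial>?L) = (\<integral>\<^sup>+z. f z * ennreal ((z i)\<^sup>2) \<partial>?L')"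
      by (subst nn_insert) auto
    finally show ?thesis
      using True by simp
  next
    case False
    with j have jI: "j \<in> I" by auto
    have [measurable]: "(\<lambda>z. z j) \<in> borel_measurable ?L'" "(\<lambda>z. z j) \<in> borel_measurable ?L"
      "g' j \<in> borel_measurable ?L"
      using measurable_component_singleton[of j "insert i I" "\<lambda>_. lborel :: real measure"]
        measurable_component_singleton[of j I "\<lambda>_. lborel :: real measure"] jI g' by simp_all
    \<comment> \<open>The cost in an old coordinate does not involve \<open>z i\<close>, so only the
      marginal density is seen.\<close>
    have collapse: "(\<integral>\<^sup>+z. f z * c (restrict z I) \<partial>?L') = (\<integral>\<^sup>+x. f' x * c x \<partial>?L)"
      if [measurable]: "c \<in> borel_measurable ?L" for c
    proof -
      have "(\<integral>\<^sup>+z. f z * c (restrict z I) \<partial>?L')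
          = (\<integral>\<^sup>+x. (\<integral>\<^sup>+t. f (x(i := t)) * c (restrict (x(i := t)) I) \<partial>lborel) \<partial>?L)"
        by (rule nn_insert) simp
      also have "\<dots> = (\<integral>\<^sup>+x. f' x * c x \<partial>?L)"
        by (intro nn_integral_cong) (simp add: restr_upd f'_def nn_integral_multc)
      finally show ?thesis .
    qed
    have "(\<integral>\<^sup>+z. f z * (ennreal ((z j - S z j)\<^sup>2) + 2 * ennreal (g j z)) \<partial>?L')
        = (\<integral>\<^sup>+x. f' x * (ennreal ((x j - S' x j)\<^sup>2) + 2 * ennreal (g' j x)) \<partial>?L)"
      using collapse[of "\<lambda>x. ennreal ((x j - S' x j)\<^sup>2) + 2 * ennreal (g' j x)"] False jI
      by (simp add: S_def g_def)
    also have "\<dots> \<le> (\<integral>\<^sup>+x. f' x * ennreal ((x j)\<^sup>2) \<partial>?L) + 1"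
      by (rule cost'[OF jI])
    also have "(\<integral>\<^sup>+x. f' x * ennreal ((x j)\<^sup>2) \<partial>?L) = (\<integral>\<^sup>+z. f z * ennreal ((z j)\<^sup>2) \<partial>?L')"
      using collapse[of "\<lambda>x. ennreal ((x j)\<^sup>2)"] jI by simp
    finally show ?thesis .
  qed
  have prod: "AE z in ?L'. 0 < f z \<longrightarrow>
      (\<Prod>j\<in>insert i I. g j z) * enn2real (f z) = (\<Prod>j\<in>insert i I. std_normal_density (S z j))"
  proof (rule lborel_prod.AE_PiM_insert[OF insert.hyps])
    have "(\<lambda>z. std_normal_density (S z j)) \<in> borel_measurable ?L'" if "j \<in> insert i I" for j
      using measurable_compose[OF measurable_compose[OF S_meas
          measurable_component_singleton[OF that, of "\<lambda>_. lborel"]], of std_normal_density borel] by simp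
    then have R: "(\<lambda>z. \<Prod>j\<in>insert i I. std_normal_density (S z j)) \<in> borel_measurable ?L'"
      by (rule borel_measurable_prod)
    have L: "(\<lambda>z. (\<Prod>j\<in>insert i I. g j z) * enn2real (f z)) \<in> borel_measurable ?L'"
      by (intro borel_measurable_times borel_measurable_prod g_meas) measurable
    show "Measurable.pred ?L' (\<lambda>z. 0 < f z \<longrightarrow>
      (\<Prod>j\<in>insert i I. g j z) * enn2real (f z) = (\<Prod>j\<in>insert i I. std_normal_density (S z j)))"
      by (intro pred_intros_logic measurable_equality_set[OF L R, folded pred_def]) measurable
    show "AE x in ?L. AE t in lborel. 0 < f (x(i := t)) \<longrightarrow>
      (\<Prod>j\<in>insert i I. g j (x(i := t))) * enn2real (f (x(i := t)))
        = (\<Prod>j\<in>insert i I. std_normal_density (S (x(i := t)) j))"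
      using f'_fin AE_space prod'
    proof eventually_elim
      case (elim x)
      note [measurable] = f_upd[OF elim(2)]
      have fin: "AE t in lborel. f (x(i := t)) \<noteq> \<infinity>"
        using elim(1) by (intro nn_integral_noteq_infinite) (auto simp: f'_def)
      \<comment> \<open>Ensures that the marginal is positive almost everywhere that
        \<open>f\<close> is, as the product identity for the marginal requires.\<close>
      have zero: "AE t in lborel. f' x = 0 \<longrightarrow> f (x(i := t)) = 0"
        by (cases "f' x = 0") (auto simp: f'_def nn_integral_0_iff_AE)
      from fin zero show ?case
      proof eventually_elim
        case t: (elim t)
        show ?case
        proof
          assume pos: "0 < f (x(i := t))"
          with t have pos': "0 < f' x" by (auto simp: zero_less_iff_neq_zero)
          \<comment> \<open>The telescoping step: the new factor turns the joint density into the
            marginal.\<close>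
          have "enn2real (f' x / f (x(i := t))) * enn2real (f (x(i := t))) = enn2real (f' x)"
            using pos t by (simp add: enn2real_mult[symmetric] ennreal_divide_times ennreal_mult_divide_eq ennreal_times_divide)
          moreover have "(\<Prod>j\<in>I. g j (x(i := t))) = (\<Prod>j\<in>I. g' j x)"
            using insert.hyps elim(2) by (intro prod.cong) (auto simp: g_def restr_upd restr_id)
          moreover have "(\<Prod>j\<in>I. std_normal_density (S (x(i := t)) j)) = (\<Prod>j\<in>I. std_normal_density (S' x j))"
            using insert.hyps elim(2) by (intro prod.cong) (auto simp: S_upd)
          moreover have "g i (x(i := t)) = std_normal_density (S (x(i := t)) i) * enn2real (f' x / f (x(i := t)))"
            using elim(2) by (simp add: g_def S_def f'_upd)
          ultimately show "(\<Prod>j\<in>insert i I. g j (x(i := t))) * enn2real (f (x(i := t)))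
              = (\<Prod>j\<in>insert i I. std_normal_density (S (x(i := t)) j))"
            using insert.hyps elim(3) pos'
            by (simp add: mult.assoc mult.left_commute[of _ "\<Prod>j\<in>I. g' j x"])
        qed
      qed
    qed
  qed
  show ?case
    by (intro exI[of _ S] exI[of _ g] conjI ballI allI S_meas g_meas g_nonneg push cost prod)
qed

section \<open>The cost of the Knothe coupling\<close>

abbreviation gaussian_measure :: "'a::euclidean_space measure" where
  "gaussian_measure \<equiv> density lborel (\<lambda>x. ennreal (\<Prod>b\<in>Basis. std_normal_density (x \<bullet> b)))"

lemma std_normal_density_pos: "0 < std_normal_density x"
  by (rule normal_density_pos) simp

lemma ln_std_normal_density: "ln (std_normal_density x) = - (ln (2 * pi)) / 2 - x\<^sup>2 / 2"
  unfolding std_normal_density_def by (simp add: ln_mult ln_div ln_sqrt field_simps)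

lemma norm_power2_eq_sum_Basis: "(norm x)\<^sup>2 = (\<Sum>b\<in>Basis. (x \<bullet> b)\<^sup>2)" for x :: "'a::euclidean_space"
  unfolding power2_norm_eq_inner by (subst euclidean_inner) (simp add: power2_eq_square)

text \<open>Each summand is bounded below by the tangent bound for the logarithm at
  \<open>l\<close>, with equality when \<open>a i\<close> = \<open>l\<close>. Optimizing
  \<open>l\<close> pointwise would give AM-GM; a fixed \<open>l\<close> keeps the bound affine in
  the logarithm of the product.\<close>

lemma sum_ge_log_prod:
  fixes a :: "'b \<Rightarrow> real"
  assumes "finite I" "0 < l" "\<And>i. i \<in> I \<Longrightarrow> 0 < a i"
  shows "l * (real (card I) * (1 - ln l) + ln (\<Prod>i\<in>I. a i)) \<le> (\<Sum>i\<in>I. a i)"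
proof -
  have "l * (1 - ln l + ln (a i)) \<le> a i" if "i \<in> I" for i
    using ln_le_minus_one[of "a i / l"] assms(2) assms(3)[OF that]
    by (simp add: ln_div field_simps)
  then have "(\<Sum>i\<in>I. l * (1 - ln l + ln (a i))) \<le> (\<Sum>i\<in>I. a i)"
    by (rule sum_mono)
  moreover have "(\<Sum>i\<in>I. ln (a i)) = ln (\<Prod>i\<in>I. a i)"
    by (intro ln_prod[symmetric] assms(1)) (metis assms(3) less_irrefl)
  ultimately show ?thesis
    by (simp add: sum_distrib_left[symmetric] sum.distrib)
qed

text \<open>The expression multiplied by 2 l comes from the lower bound on the expected sum of the
  g_j. There E[ln prod g_j] = E[ln phi(S)] - E[ln p], and since each S_j has second moment 1, the
  Gaussian term is - d ln(2 pi) / 2 - d / 2.\<close>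

lemma knothe_coupling:
  fixes p :: "'a::euclidean_space \<Rightarrow> real" and \<mu> :: "'a measure" and l :: real
  assumes \<mu>: "\<mu> = density lborel (\<lambda>x. ennreal (p x))"
    and p[measurable]: "p \<in> borel_measurable borel" and p_nonneg: "\<And>x. 0 \<le> p x"
    and "prob_space \<mu>"
    and sq: "integrable \<mu> (\<lambda>x. (norm x)\<^sup>2)"
    and ent: "integrable \<mu> (\<lambda>x. ln (p x))"
    and l: "0 < l"
  shows "\<exists>\<pi>\<in>couplings \<mu> gaussian_measure. \<exists>c\<ge>0. (\<integral>\<^sup>+q. ennreal ((norm (fst q - snd q))\<^sup>2) \<partial>\<pi>) = ennreal c \<and>
    c \<le> (\<integral>x. (norm x)\<^sup>2 \<partial>\<mu>) + DIM('a)
      - 2 * l * (DIM('a) * (1 - ln l) - DIM('a) * ln (2 * pi) / 2 - DIM('a) / 2 - (\<integral>x. ln (p x) \<partial>\<mu>))"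
proof -
  interpret \<mu>: prob_space \<mu> by fact
  define P :: "('a \<Rightarrow> real) measure" where "P = Pi\<^sub>M Basis (\<lambda>_. lborel)"
  define e :: "('a \<Rightarrow> real) \<Rightarrow> 'a" where "e z = (\<Sum>b\<in>Basis. z b *\<^sub>R b)" for z
  have comp[measurable]: "(\<lambda>z. z b) \<in> borel_measurable P" if "b \<in> Basis" for b
    using measurable_component_singleton[OF that, of "\<lambda>_. lborel :: real measure"] by (simp add: P_def)
  have e[measurable]: "e \<in> borel_measurable P"
    unfolding e_def by (intro borel_measurable_sum borel_measurable_scaleR comp) auto
  have lb: "(lborel :: 'a measure) = distr P borel e"
    unfolding P_def e_def by (rule lborel_eq)
  have e_inner: "e z \<bullet> b = z b" if "b \<in> Basis" for z b
    unfolding e_def using that by simp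
  have norm_e: "(norm (e z - e w))\<^sup>2 = (\<Sum>b\<in>Basis. (z b - w b)\<^sup>2)" for z w
    unfolding norm_power2_eq_sum_Basis by (intro sum.cong) (auto simp: inner_diff_left e_inner)
  define f where "f z = ennreal (p (e z))" for z
  have f[measurable]: "f \<in> borel_measurable P"
    unfolding f_def by measurable
  define N where "N = density P f"
  have \<mu>_distr: "\<mu> = distr N borel e"
    unfolding \<mu> lb N_def f_def by (rule density_distr) simp_all
  have N_meas[measurable_cong]: "sets N = sets P"
    by (simp add: N_def)
  interpret N: prob_space N
    using \<mu>.prob_space_axioms unfolding \<mu>_distr by (rule prob_space_distrD[rotated]) measurable
  have "(\<integral>\<^sup>+z. f z \<partial>P) = 1"
    using N.emeasure_space_1 by (simp add: N_def emeasure_density cong: nn_integral_cong_simp)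
  from knothe_map_exists[OF finite_Basis f[unfolded P_def] this[unfolded P_def], folded P_def]
  obtain S g where S[measurable]: "S \<in> measurable P P"
    and g[measurable]: "\<And>j. j \<in> Basis \<Longrightarrow> g j \<in> borel_measurable P" and g_nonneg: "\<And>j z. 0 \<le> g j z"
    and push: "\<And>h. h \<in> borel_measurable P \<Longrightarrow> (\<integral>\<^sup>+z. f z * h (S z) \<partial>P)
        = (\<integral>\<^sup>+z. (\<Prod>j\<in>Basis. ennreal (std_normal_density (z j))) * h z \<partial>P)"
    and cost: "\<And>j. j \<in> Basis \<Longrightarrow> (\<integral>\<^sup>+z. f z * (ennreal ((z j - S z j)\<^sup>2) + 2 * ennreal (g j z)) \<partial>P)
        \<le> (\<integral>\<^sup>+z. f z * ennreal ((z j)\<^sup>2) \<partial>P) + 1"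
    and prod: "AE z in P. 0 < f z \<longrightarrow>
        (\<Prod>j\<in>Basis. g j z) * enn2real (f z) = (\<Prod>j\<in>Basis. std_normal_density (S z j))"
    by (elim exE conjE) (rule that, blast+)
  have Sj[measurable]: "(\<lambda>z. S z j) \<in> borel_measurable P" if "j \<in> Basis" for j
    using measurable_compose[OF S comp[OF that]] .
  have N_eq: "(\<integral>\<^sup>+z. h z \<partial>N) = (\<integral>\<^sup>+z. f z * h z \<partial>P)" if "h \<in> borel_measurable P" for h
    unfolding N_def using that by (simp add: nn_integral_density)
  have gauss: "distr N borel (\<lambda>z. e (S z)) = (gaussian_measure :: 'a measure)"
  proof (rule measure_eqI)
    fix A :: "'a set" assume "A \<in> sets (distr N borel (\<lambda>z. e (S z)))"
    then have A[measurable]: "A \<in> sets borel" by simp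
    have "emeasure (distr N borel (\<lambda>z. e (S z))) A = (\<integral>\<^sup>+z. indicator A (e (S z)) \<partial>N)"
      by (subst nn_integral_distr[symmetric, of _ _ borel]) auto
    also have "\<dots> = (\<integral>\<^sup>+z. f z * indicator A (e (S z)) \<partial>P)"
      by (rule N_eq) measurable
    also have "\<dots> = (\<integral>\<^sup>+z. (\<Prod>j\<in>Basis. ennreal (std_normal_density (z j))) * indicator A (e z) \<partial>P)"
      by (rule push) measurable
    also have "\<dots> = (\<integral>\<^sup>+z. ennreal (\<Prod>b\<in>Basis. std_normal_density (e z \<bullet> b)) * indicator A (e z) \<partial>P)"
      by (intro nn_integral_cong) (simp add: e_inner prod_ennreal normal_density_nonneg)
    also have "\<dots> = (\<integral>\<^sup>+x. ennreal (\<Prod>b\<in>Basis. std_normal_density (x \<bullet> b)) * indicator A x \<partial>lborel)"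
      unfolding lb by (rule nn_integral_distr[symmetric]) measurable
    also have "\<dots> = emeasure gaussian_measure A"
      by (simp add: emeasure_density)
    finally show "emeasure (distr N borel (\<lambda>z. e (S z))) A = emeasure gaussian_measure A" .
  qed simp
  have S2: "has_bochner_integral N (\<lambda>z. (S z j)\<^sup>2) 1" if j: "j \<in> Basis" for j
  proof (rule has_bochner_integral_nn_integral)
    note [measurable] = comp[OF j] Sj[OF j]
    have "(\<integral>\<^sup>+z. ennreal ((S z j)\<^sup>2) \<partial>N) = (\<integral>\<^sup>+z. f z * ennreal ((S z j)\<^sup>2) \<partial>P)"
      by (rule N_eq) simp
    also have "\<dots> = (\<integral>\<^sup>+z. (\<Prod>i\<in>Basis. ennreal (std_normal_density (z i))) * ennreal ((z j)\<^sup>2) \<partial>P)"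
      by (rule push) simp
    \<comment> \<open>Absorbing the square into factor \<open>j\<close> makes the integrand a
      product of one-variable functions, so the integral factorizes.\<close>
    also have "\<dots> = (\<integral>\<^sup>+z. (\<Prod>i\<in>Basis. ennreal (std_normal_density (z i)) * (if i = j then ennreal ((z i)\<^sup>2) else 1)) \<partial>P)"
      using j by (intro nn_integral_cong) (simp add: prod.distrib prod.delta)
    also have "\<dots> = (\<Prod>i\<in>Basis. \<integral>\<^sup>+x. ennreal (std_normal_density x) * (if i = j then ennreal (x\<^sup>2) else 1) \<partial>lborel)"
      unfolding P_def
      by (rule lborel_prod.product_nn_integral_prod[where f="\<lambda>i x. ennreal (std_normal_density x) * (if i = j then ennreal (x\<^sup>2) else 1)"]) auto
    also have "\<dots> = (\<Prod>i\<in>(Basis::'a set). 1)"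
    proof (rule prod.cong)
      fix i :: 'a
      have "(\<integral>\<^sup>+x. ennreal (std_normal_density x) * ennreal (x\<^sup>2) \<partial>lborel) = (\<integral>\<^sup>+x. ennreal (std_normal_density x * x ^ (2 * 1)) \<partial>lborel)"
        by (simp add: ennreal_mult normal_density_nonneg)
      also have "\<dots> = ennreal (fact (2 * 1) / (2 ^ 1 * fact 1))"
        using std_normal_moment_even[of 1] by (subst nn_integral_eq_integral)
          (auto simp: has_bochner_integral_iff normal_density_nonneg)
      finally have 1: "(\<integral>\<^sup>+x. ennreal (std_normal_density x) * ennreal (x\<^sup>2) \<partial>lborel) = 1"
        by simp
      have 2: "(\<integral>\<^sup>+x. ennreal (std_normal_density x) \<partial>lborel) = 1"
        using std_normal.emeasure_space_1 by (simp add: emeasure_density)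
      show "(\<integral>\<^sup>+x. ennreal (std_normal_density x) * (if i = j then ennreal (x\<^sup>2) else 1) \<partial>lborel) = 1"
        using 1 2 by (cases "i = j") auto
    qed simp
    finally show "(\<integral>\<^sup>+z. ennreal ((S z j)\<^sup>2) \<partial>N) = ennreal 1" by simp
  qed (use Sj[OF j] in auto)
  define T where "T z = (\<Sum>j\<in>Basis. (z j - S z j)\<^sup>2)" for z
  define G where "G z = (\<Sum>j\<in>Basis. g j z)" for z
  have [measurable]: "T \<in> borel_measurable P" "G \<in> borel_measurable P"
    unfolding T_def G_def by measurable
  have T_nonneg: "0 \<le> T z" and G_nonneg: "0 \<le> G z" for z
    by (auto simp: T_def G_def g_nonneg intro!: sum_nonneg)
  have m2: "(\<integral>x. (norm x)\<^sup>2 \<partial>\<mu>) = (\<integral>z. (\<Sum>j\<in>Basis. (z j)\<^sup>2) \<partial>N)"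
    and sq_N: "integrable N (\<lambda>z. \<Sum>j\<in>Basis. (z j)\<^sup>2)"
  proof -
    have "(norm (e z))\<^sup>2 = (\<Sum>j\<in>Basis. (z j)\<^sup>2)" for z
      unfolding norm_power2_eq_sum_Basis by (intro sum.cong) (auto simp: e_inner)
    then show "(\<integral>x. (norm x)\<^sup>2 \<partial>\<mu>) = (\<integral>z. (\<Sum>j\<in>Basis. (z j)\<^sup>2) \<partial>N)" "integrable N (\<lambda>z. \<Sum>j\<in>Basis. (z j)\<^sup>2)"
      using sq unfolding \<mu>_distr by (auto simp: integral_distr integrable_distr_eq)
  qed
  have cost_meas: "(\<lambda>z. ennreal ((z j - S z j)\<^sup>2) + 2 * ennreal (g j z)) \<in> borel_measurable P"
    if "j \<in> Basis" for j
  proof -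
    note [measurable] = comp[OF that] Sj[OF that] g[OF that]
    show ?thesis by measurable
  qed
  have total: "(\<integral>\<^sup>+z. ennreal (T z + 2 * G z) \<partial>N) \<le> ennreal ((\<integral>x. (norm x)\<^sup>2 \<partial>\<mu>) + DIM('a))"
  proof -
    have "(\<integral>\<^sup>+z. ennreal (T z + 2 * G z) \<partial>N)
        = (\<integral>\<^sup>+z. (\<Sum>j\<in>Basis. ennreal ((z j - S z j)\<^sup>2) + 2 * ennreal (g j z)) \<partial>N)"
    proof (rule nn_integral_cong)
      fix z
      have "T z + 2 * G z = (\<Sum>j\<in>Basis. (z j - S z j)\<^sup>2 + 2 * g j z)"
        by (simp add: T_def G_def sum.distrib sum_distrib_left)
      then show "ennreal (T z + 2 * G z) = (\<Sum>j\<in>Basis. ennreal ((z j - S z j)\<^sup>2) + 2 * ennreal (g j z))"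
        by (simp add: sum_ennreal[symmetric] g_nonneg ennreal_mult)
    qed
    also have "\<dots> = (\<Sum>j\<in>Basis. \<integral>\<^sup>+z. ennreal ((z j - S z j)\<^sup>2) + 2 * ennreal (g j z) \<partial>N)"
      using cost_meas by (intro nn_integral_sum) (simp cong: measurable_cong_sets)
    also have "\<dots> = (\<Sum>j\<in>Basis. \<integral>\<^sup>+z. f z * (ennreal ((z j - S z j)\<^sup>2) + 2 * ennreal (g j z)) \<partial>P)"
      by (rule sum.cong[OF refl N_eq]) (rule cost_meas)
    also have "\<dots> \<le> (\<Sum>j\<in>Basis. (\<integral>\<^sup>+z. f z * ennreal ((z j)\<^sup>2) \<partial>P) + 1)"
      by (intro sum_mono cost)
    also have "\<dots> = (\<Sum>j\<in>Basis. (\<integral>\<^sup>+z. ennreal ((z j)\<^sup>2) \<partial>N)) + ennreal (DIM('a))"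
    proof -
      have "(\<integral>\<^sup>+z. f z * ennreal ((z j)\<^sup>2) \<partial>P) = (\<integral>\<^sup>+z. ennreal ((z j)\<^sup>2) \<partial>N)" if "j \<in> Basis" for j
      proof -
        note [measurable] = comp[OF that]
        show ?thesis by (intro N_eq[symmetric]) measurable
      qed
      then show ?thesis
        by (simp add: sum.distrib ennreal_of_nat_eq_real_of_nat)
    qed
    also have "(\<Sum>j\<in>Basis. (\<integral>\<^sup>+z. ennreal ((z j)\<^sup>2) \<partial>N)) = (\<integral>\<^sup>+z. ennreal (\<Sum>j\<in>Basis. (z j)\<^sup>2) \<partial>N)"
      by (subst nn_integral_sum[symmetric]) (use comp in \<open>auto simp: sum_ennreal\<close>)
    also have "\<dots> = ennreal (\<integral>x. (norm x)\<^sup>2 \<partial>\<mu>)"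
      unfolding m2 by (rule nn_integral_eq_integral[OF sq_N]) (auto intro!: sum_nonneg)
    finally show ?thesis
      by (simp add: ennreal_plus[symmetric] del: ennreal_plus)
  qed
  \<comment> \<open>Finite second moments make the total bound finite, so the nonnegative integrals
    can now be treated as real ones and separated.\<close>
  have int_TG: "integrable N (\<lambda>z. T z + 2 * G z)"
    using total T_nonneg G_nonneg by (intro integrableI_bounded) (auto intro: le_less_trans)
  have int_T: "integrable N T" and int_G: "integrable N G"
    using T_nonneg G_nonneg by (auto intro!: Bochner_Integration.integrable_bound[OF int_TG] AE_I2)
  have TG: "(\<integral>z. T z \<partial>N) + 2 * (\<integral>z. G z \<partial>N) \<le> (\<integral>x. (norm x)\<^sup>2 \<partial>\<mu>) + DIM('a)"
  proof -
    have "ennreal (\<integral>z. T z + 2 * G z \<partial>N) \<le> ennreal ((\<integral>x. (norm x)\<^sup>2 \<partial>\<mu>) + DIM('a))"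
      using total T_nonneg G_nonneg by (subst (asm) nn_integral_eq_integral[OF int_TG]) auto
    then have "(\<integral>z. T z + 2 * G z \<partial>N) \<le> (\<integral>x. (norm x)\<^sup>2 \<partial>\<mu>) + DIM('a)"
      by (subst (asm) ennreal_le_iff) auto
    then show ?thesis
      using int_T int_G by simp
  qed
  have ent_N: "integrable N (\<lambda>z. ln (p (e z)))" "(\<integral>z. ln (p (e z)) \<partial>N) = (\<integral>x. ln (p x) \<partial>\<mu>)"
    using ent unfolding \<mu>_distr by (auto simp: integral_distr integrable_distr_eq)
  define B where "B z = (\<Sum>j\<in>Basis. - (ln (2 * pi)) / 2 - (S z j)\<^sup>2 / 2)" for z
  have B: "has_bochner_integral N B (\<Sum>j\<in>(Basis::'a set). - (ln (2 * pi)) / 2 - 1 / 2)"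
  proof -
    have "has_bochner_integral N (\<lambda>z. - (ln (2 * pi)) / 2 - (S z j)\<^sup>2 / 2) (- (ln (2 * pi)) / 2 - 1 / 2)"
      if "j \<in> Basis" for j
    proof (rule has_bochner_integral_diff)
      show "has_bochner_integral N (\<lambda>_. - (ln (2 * pi)) / 2) (- (ln (2 * pi)) / 2)"
        by (simp add: has_bochner_integral_iff N.prob_space)
      show "has_bochner_integral N (\<lambda>z. (S z j)\<^sup>2 / 2) (1 / 2)"
        using has_bochner_integral_divide[OF S2[OF that], of 2] by simp
    qed
    then show ?thesis
      unfolding B_def by (rule has_bochner_integral_sum)
  qed
  have G_ge: "AE z in N. l * (DIM('a) * (1 - ln l) + (B z - ln (p (e z)))) \<le> G z"
    unfolding N_def AE_density[OF f]
    using prod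
  proof eventually_elim
    case (elim z)
    show ?case
    proof
      assume fz: "0 < f z"
      then have pz: "0 < p (e z)" by (simp add: f_def)
      with elim fz have eq: "(\<Prod>j\<in>Basis. g j z) * p (e z) = (\<Prod>j\<in>Basis. std_normal_density (S z j))"
        by (simp add: f_def)
      have pos: "0 < (\<Prod>j\<in>Basis. std_normal_density (S z j))"
        by (intro prod_pos std_normal_density_pos)
      \<comment> \<open>Nonnegative factors with a nonzero product are positive, which is what
        taking logarithms needs.\<close>
      have "(\<Prod>j\<in>Basis. g j z) \<noteq> 0"
      proof
        assume "(\<Prod>j\<in>Basis. g j z) = 0"
        with eq pos show False by (simp only: mult_zero_left less_irrefl)
      qed
      then have g_pos: "0 < g j z" if "j \<in> Basis" for j
        using that g_nonneg[of j z] by (auto simp: less_le)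
      have "ln (\<Prod>j\<in>Basis. g j z) + ln (p (e z)) = ln ((\<Prod>j\<in>Basis. g j z) * p (e z))"
        by (rule ln_mult_pos[symmetric]) (auto intro!: prod_pos g_pos pz)
      also have "\<dots> = B z"
        unfolding eq B_def ln_std_normal_density[symmetric] by (intro ln_prod) (auto simp: std_normal_density_pos less_imp_neq[OF std_normal_density_pos, symmetric])
      finally have "B z - ln (p (e z)) = ln (\<Prod>j\<in>Basis. g j z)"
        by simp
      then show "l * (DIM('a) * (1 - ln l) + (B z - ln (p (e z)))) \<le> G z"
        using sum_ge_log_prod[OF finite_Basis l, of "\<lambda>j. g j z"] g_pos
        by (simp add: G_def)
    qed
  qed
  have intB: "integrable N B" and B_eq: "(\<integral>z. B z \<partial>N) = DIM('a) * (- (ln (2 * pi)) / 2 - 1 / 2)"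
    using B by (auto simp: has_bochner_integral_iff)
  have "l * (DIM('a) * (1 - ln l) + (DIM('a) * (- (ln (2 * pi)) / 2 - 1 / 2) - (\<integral>x. ln (p x) \<partial>\<mu>)))
      = (\<integral>z. l * (DIM('a) * (1 - ln l) + (B z - ln (p (e z)))) \<partial>N)"
    using intB ent_N B_eq by (simp add: N.prob_space)
  also have "\<dots> \<le> (\<integral>z. G z \<partial>N)"
    using G_ge intB ent_N int_G by (intro integral_mono_AE) auto
  finally have G_int: "l * (DIM('a) * (1 - ln l) + (DIM('a) * (- (ln (2 * pi)) / 2 - 1 / 2) - (\<integral>x. ln (p x) \<partial>\<mu>)))
      \<le> (\<integral>z. G z \<partial>N)" .
  define \<pi> where "\<pi> = distr N (borel \<Otimes>\<^sub>M borel) (\<lambda>z. (e z, e (S z)))"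
  have \<mu>_sets: "sets \<mu> = sets borel"
    by (simp add: \<mu>)
  have "\<pi> \<in> couplings \<mu> gaussian_measure"
  proof -
    have "distr \<pi> \<mu> fst = distr N borel e"
      unfolding \<pi>_def using \<mu>_sets by (subst distr_distr) (auto simp: comp_def cong: measurable_cong_sets distr_cong)
    moreover have "distr \<pi> gaussian_measure snd = distr N borel (\<lambda>z. e (S z))"
      unfolding \<pi>_def by (subst distr_distr) (auto simp: comp_def cong: measurable_cong_sets distr_cong)
    moreover have "sets \<pi> = sets (\<mu> \<Otimes>\<^sub>M (gaussian_measure :: 'a measure))"
      unfolding \<pi>_def by (simp add: \<mu>_sets cong: sets_pair_measure_cong)
    ultimately show ?thesis
      unfolding couplings_def using \<mu>_distr gauss by simp
  qed
  moreover have "(\<integral>\<^sup>+q. ennreal ((norm (fst q - snd q))\<^sup>2) \<partial>\<pi>) = ennreal (\<integral>z. T z \<partial>N)"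
  proof -
    have "(\<integral>\<^sup>+q. ennreal ((norm (fst q - snd q))\<^sup>2) \<partial>\<pi>) = (\<integral>\<^sup>+z. ennreal (T z) \<partial>N)"
      unfolding \<pi>_def by (subst nn_integral_distr) (auto simp: norm_e T_def)
    also have "\<dots> = ennreal (\<integral>z. T z \<partial>N)"
      using T_nonneg by (intro nn_integral_eq_integral int_T) auto
    finally show ?thesis .
  qed
  moreover have "(\<integral>z. T z \<partial>N) \<le> (\<integral>x. (norm x)\<^sup>2 \<partial>\<mu>) + DIM('a)
      - 2 * l * (DIM('a) * (1 - ln l) - DIM('a) * ln (2 * pi) / 2 - DIM('a) / 2 - (\<integral>x. ln (p x) \<partial>\<mu>))"
    using TG G_int by (simp add: algebra_simps)
  ultimately show ?thesis
    using T_nonneg by (intro bexI[of _ \<pi>] exI[of _ "\<integral>z. T z \<partial>N"]) auto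
qed

section \<open>The deficit in Talagrand's inequality\<close>

lemma std_gaussian_eq: "std_gaussian = (gaussian_measure :: (real ^ 'n) measure)"
proof -
  have "(\<Prod>i\<in>UNIV. std_normal_density (x $ i)) = (\<Prod>b\<in>Basis. std_normal_density (x \<bullet> b))" for x :: "real ^ 'n"
  proof -
    have "Basis = range (\<lambda>i. axis i 1 :: real ^ 'n)"
      by (auto simp: Basis_vec_def)
    moreover have "(\<Prod>b\<in>range (\<lambda>i. axis i 1 :: real ^ 'n). std_normal_density (x \<bullet> b))
        = (\<Prod>i\<in>UNIV. std_normal_density (x $ i))"
      by (subst prod.reindex) (auto simp: inj_def axis_eq_axis inner_axis)
    ultimately show ?thesis
      by (simp only:)
  qed
  then show ?thesis
    by (simp add: std_gaussian_def)
qed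

text \<open>Centering enters here: it turns the trace hypothesis into a bound on the second moment,
  which is what the cost estimate involves.\<close>

lemma trace_covariance_matrix_centered:
  fixes \<mu> :: "(real ^ 'n) measure"
  assumes sets: "sets \<mu> = sets borel"
    and sq: "integrable \<mu> (\<lambda>x. (norm x)\<^sup>2)"
    and "(\<integral>x. x \<partial>\<mu>) = 0"
  shows "trace (covariance_matrix \<mu>) = (\<integral>x. (norm x)\<^sup>2 \<partial>\<mu>)"
proof -
  have [measurable]: "(\<lambda>x. x $ i) \<in> borel_measurable \<mu>" for i
    by (simp add: measurable_cong_sets[OF sets refl])
  have norm_eq: "(norm x)\<^sup>2 = (\<Sum>i\<in>UNIV. (x $ i)\<^sup>2)" for x :: "real ^ 'n"
    unfolding power2_norm_eq_inner by (simp add: inner_vec_def power2_eq_square)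
  have int: "integrable \<mu> (\<lambda>x. (x $ i)\<^sup>2)" for i
  proof (rule Bochner_Integration.integrable_bound[OF sq])
    show "AE x in \<mu>. norm ((x $ i)\<^sup>2) \<le> norm ((norm x)\<^sup>2)"
      unfolding norm_eq by (intro AE_I2) (auto intro!: member_le_sum simp: sum_nonneg)
  qed simp
  have "trace (covariance_matrix \<mu>) = (\<Sum>i\<in>UNIV. \<integral>x. (x $ i)\<^sup>2 \<partial>\<mu>)"
    using assms(3) by (simp add: trace_def covariance_matrix_def Let_def power2_eq_square)
  also have "\<dots> = (\<integral>x. (norm x)\<^sup>2 \<partial>\<mu>)"
    unfolding norm_eq using int by simp
  finally show ?thesis .
qed

text \<open>Passing from the Lebesgue density to the density relative to the Gaussian replaces
  E[ln p] by D - d ln(2 pi) / 2 - E|X|^2 / 2. The terms with ln(2 pi) cancel, and the second moment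
  acquires the factor 1 - l.\<close>

lemma transport_cost_le:
  fixes \<mu> :: "(real ^ 'n) measure" and l :: real
  assumes "prob_space \<mu>" and sets: "sets \<mu> = sets borel"
    and sq: "integrable \<mu> (\<lambda>x. (norm x)\<^sup>2)"
    and ac: "absolutely_continuous std_gaussian \<mu>"
    and ent: "integrable \<mu> (entropy_density (exp 1) std_gaussian \<mu>)"
    and l: "0 < l"
  shows "\<exists>c\<ge>0. transport_cost2 \<mu> std_gaussian \<le> ennreal c \<and>
    c \<le> (1 - l) * (\<integral>x. (norm x)\<^sup>2 \<partial>\<mu>) + CARD('n) * (1 - l) + 2 * l * CARD('n) * ln l
      + 2 * l * KL_divergence (exp 1) std_gaussian \<mu>"
proof -
  interpret \<mu>: prob_space \<mu> by fact
  define \<phi> where "\<phi> x = (\<Prod>b\<in>Basis. std_normal_density (x \<bullet> b))" for x :: "real ^ 'n"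
  have \<phi>_pos: "0 < \<phi> x" for x
    unfolding \<phi>_def by (intro prod_pos std_normal_density_pos)
  have [measurable]: "\<phi> \<in> borel_measurable borel"
    unfolding \<phi>_def by measurable
  have \<gamma>: "std_gaussian = density lborel (\<lambda>x. ennreal (\<phi> x))"
    by (simp add: std_gaussian_eq \<phi>_def)
  have \<gamma>_sets[measurable_cong]: "sets (std_gaussian :: (real ^ 'n) measure) = sets borel"
    by (simp add: \<gamma>)
  interpret \<gamma>: sigma_finite_measure "std_gaussian :: (real ^ 'n) measure"
    unfolding \<gamma> by (subst sigma_finite_measure.sigma_finite_iff_density_finite[OF sigma_finite_lborel]) auto
  define h where "h = (\<lambda>x. enn2real (RN_deriv std_gaussian \<mu> x))"
  have h[measurable]: "h \<in> borel_measurable borel"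
    unfolding h_def by (simp add: measurable_cong_sets[OF \<gamma>_sets refl, symmetric])
  have RN: "density std_gaussian (RN_deriv std_gaussian \<mu>) = \<mu>"
    by (intro \<gamma>.density_RN_deriv ac) (simp add: sets \<gamma>_sets)
  have "AE x in std_gaussian. RN_deriv std_gaussian \<mu> x = ennreal (h x)"
    using \<gamma>.RN_deriv_finite[OF _ ac] sets \<gamma>_sets \<mu>.sigma_finite_measure_axioms
    by (auto simp: h_def less_top)
  then have "density std_gaussian (\<lambda>x. ennreal (h x)) = density std_gaussian (RN_deriv std_gaussian \<mu>)"
    by (intro density_cong) (auto elim!: AE_mp)
  then have \<mu>_h: "\<mu> = density std_gaussian (\<lambda>x. ennreal (h x))"
    by (simp add: RN)
  define p where "p x = \<phi> x * h x" for x
  have h_nonneg: "0 \<le> h x" for x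
    by (simp add: h_def)
  have p_nonneg: "0 \<le> p x" for x
    using \<phi>_pos[of x] h_nonneg[of x] by (simp add: p_def)
  have [measurable]: "p \<in> borel_measurable borel"
    unfolding p_def by measurable
  have \<mu>_p: "\<mu> = density lborel (\<lambda>x. ennreal (p x))"
    unfolding \<mu>_h \<gamma> p_def using \<phi>_pos h_nonneg
    by (subst density_density_eq) (auto simp: ennreal_mult less_imp_le)
  \<comment> \<open>The zeros of a density are null for its own measure, so the logarithm of the
    product can be split almost everywhere.\<close>
  have h_pos: "AE x in \<mu>. 0 < h x"
    by (subst \<mu>_h, subst AE_density) (auto simp: measurable_cong_sets[OF \<gamma>_sets refl])
  have ln_phi: "ln (\<phi> x) = - (CARD('n) * ln (2 * pi) / 2) - (norm x)\<^sup>2 / 2" for x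
  proof -
    have "ln (\<phi> x) = (\<Sum>b\<in>Basis. ln (std_normal_density (x \<bullet> b)))"
      unfolding \<phi>_def by (intro ln_prod) (auto simp: std_normal_density_pos less_imp_neq[OF std_normal_density_pos, symmetric])
    then show ?thesis
      by (simp add: ln_std_normal_density sum_subtractf norm_power2_eq_sum_Basis sum_divide_distrib[symmetric])
  qed
  have ln_p: "AE x in \<mu>. ln (p x) = entropy_density (exp 1) std_gaussian \<mu> x + (- (CARD('n) * ln (2 * pi) / 2) - (norm x)\<^sup>2 / 2)"
    using h_pos
  proof eventually_elim
    case (elim x)
    then have "ln (p x) = ln (\<phi> x) + ln (h x)"
      unfolding p_def by (intro ln_mult_pos \<phi>_pos)
    then show ?case
      by (simp add: ln_phi entropy_density_def log_def h_def)
  qed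
  have int2: "integrable \<mu> (\<lambda>x. entropy_density (exp 1) std_gaussian \<mu> x + (- (CARD('n) * ln (2 * pi) / 2) - (norm x)\<^sup>2 / 2))"
    using ent sq by auto
  have p_meas: "(\<lambda>x. ln (p x)) \<in> borel_measurable \<mu>"
    by (simp add: measurable_cong_sets[OF sets refl])
  have int_p: "integrable \<mu> (\<lambda>x. ln (p x))"
    using integrable_cong_AE[OF p_meas borel_measurable_integrable[OF int2] ln_p] int2 by blast
  have "(\<integral>x. ln (p x) \<partial>\<mu>) = (\<integral>x. entropy_density (exp 1) std_gaussian \<mu> x + (- (CARD('n) * ln (2 * pi) / 2) - (norm x)\<^sup>2 / 2) \<partial>\<mu>)"
    by (rule integral_cong_AE[OF p_meas borel_measurable_integrable[OF int2] ln_p])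
  also have "\<dots> = KL_divergence (exp 1) std_gaussian \<mu> - CARD('n) * ln (2 * pi) / 2 - (\<integral>x. (norm x)\<^sup>2 \<partial>\<mu>) / 2"
    using ent sq by (simp add: KL_divergence_def \<mu>.prob_space)
  finally have int_eq: "(\<integral>x. ln (p x) \<partial>\<mu>) = \<dots>" .
  obtain \<pi> c where \<pi>: "\<pi> \<in> couplings \<mu> (gaussian_measure :: (real ^ 'n) measure)" "0 \<le> c"
    "(\<integral>\<^sup>+q. ennreal ((norm (fst q - snd q))\<^sup>2) \<partial>\<pi>) = ennreal c"
    "c \<le> (\<integral>x. (norm x)\<^sup>2 \<partial>\<mu>) + DIM(real ^ 'n)
      - 2 * l * (DIM(real ^ 'n) * (1 - ln l) - DIM(real ^ 'n) * ln (2 * pi) / 2 - DIM(real ^ 'n) / 2 - (\<integral>x. ln (p x) \<partial>\<mu>))"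
    using knothe_coupling[OF \<mu>_p _ p_nonneg \<open>prob_space \<mu>\<close> sq int_p l] by auto
  have "transport_cost2 \<mu> std_gaussian \<le> ennreal c"
    unfolding transport_cost2_def std_gaussian_eq \<pi>(3)[symmetric] by (rule INF_lower[OF \<pi>(1)])
  moreover have "c \<le> (1 - l) * (\<integral>x. (norm x)\<^sup>2 \<partial>\<mu>) + CARD('n) * (1 - l) + 2 * l * CARD('n) * ln l
      + 2 * l * KL_divergence (exp 1) std_gaussian \<mu>"
    using \<pi>(4) unfolding int_eq by (simp add: algebra_simps)
  ultimately show ?thesis
    using \<pi>(2) by blast
qed

theorem theorem3:
  fixes \<mu> :: "(real ^ 'n) measure"
  assumes "prob_space \<mu>"
    and "sets \<mu> = sets borel"
    and "integrable \<mu> (\<lambda>x. (norm x)\<^sup>2)"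
    and "(\<integral>x. x \<partial>\<mu>) = 0"
    and "trace (covariance_matrix \<mu>) \<le> real CARD('n)"
  shows "talagrand_deficit \<mu> \<ge>
           min ((relative_entropy \<mu> std_gaussian)\<^sup>2 / ereal (6 * real CARD('n)))
               (relative_entropy \<mu> std_gaussian / 4)"
proof (cases "relative_entropy \<mu> std_gaussian = \<infinity>")
  case True
  then show ?thesis by (simp add: talagrand_deficit_def)
next
  case False
  define D where "D = KL_divergence (exp 1) std_gaussian \<mu>"
  define d where "d = real CARD('n)"
  define m2 where "m2 = (\<integral>x. (norm x)\<^sup>2 \<partial>\<mu>)"
  have ac: "absolutely_continuous std_gaussian \<mu>"
    and ent: "integrable \<mu> (entropy_density (exp 1) std_gaussian \<mu>)"
    using False by (auto simp: relative_entropy_def split: if_splits)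
  have D: "relative_entropy \<mu> std_gaussian = ereal D"
    using ac ent by (simp add: relative_entropy_def D_def)
  have d: "0 < d" by (simp add: d_def)
  have m2: "m2 \<le> d"
    using trace_covariance_matrix_centered[OF assms(2-4)] assms(5) by (simp add: m2_def d_def)
  have bound: "\<exists>c\<ge>0. transport_cost2 \<mu> std_gaussian \<le> ennreal c \<and>
      c \<le> (1 - l) * m2 + d * (1 - l) + 2 * l * d * ln l + 2 * l * D" if "0 < l" for l
    using transport_cost_le[OF assms(1-3) ac ent that] by (simp add: D_def d_def m2_def)
  \<comment> \<open>At l = 1 the bound reads 0 <= c <= 2 D.\<close>
  have D_nonneg: "0 \<le> D"
    using bound[of 1] by auto
  \<comment> \<open>Here s = 1 - l, and D / (2 d) maximizes the gain 2 s D - 2 d s^2 obtained below.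
    The cap 1/2 keeps l positive when D is large.\<close>
  define s where "s = (if D \<le> d then D / (2 * d) else 1 / 2)"
  have s: "0 \<le> s" "s \<le> 1 / 2"
    using D_nonneg d by (auto simp: s_def field_simps)
  obtain c where c: "0 \<le> c" "transport_cost2 \<mu> std_gaussian \<le> ennreal c"
    "c \<le> s * m2 + d * s + 2 * (1 - s) * d * ln (1 - s) + 2 * (1 - s) * D"
    using bound[of "1 - s"] s by auto
  have "2 * (1 - s) * d * ln (1 - s) \<le> 2 * (1 - s) * d * (- s)"
    using ln_le_minus_one[of "1 - s"] s d by (intro mult_left_mono) auto
  moreover have "s * m2 \<le> s * d"
    using m2 s by (intro mult_left_mono)
  ultimately have gap: "2 * s * D - 2 * d * s\<^sup>2 \<le> 2 * D - c"
    using c(3) by (simp add: algebra_simps power2_eq_square)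
  \<comment> \<open>The gain is D^2 / (2 d) in the first regime and D - d/2 >= D/2 in the second, so
    the constants 6 and 4 leave room.\<close>
  have "min (D\<^sup>2 / (6 * d)) (D / 4) \<le> 2 * s * D - 2 * d * s\<^sup>2"
  proof (cases "D \<le> d")
    case True
    then have "2 * s * D - 2 * d * s\<^sup>2 = D\<^sup>2 / (2 * d)"
      using d by (simp add: s_def field_simps power2_eq_square)
    moreover have "D\<^sup>2 / (6 * d) \<le> D\<^sup>2 / (2 * d)"
      using d by (intro divide_left_mono) auto
    ultimately show ?thesis by simp
  next
    case False
    then have "2 * s * D - 2 * d * s\<^sup>2 = D - d / 2"
      by (simp add: s_def power2_eq_square)
    with False D_nonneg show ?thesis by simp
  qed
  with gap have main: "min (D\<^sup>2 / (6 * d)) (D / 4) \<le> 2 * D - c" by simp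
  have "(wasserstein2 \<mu> std_gaussian)\<^sup>2 \<le> ereal c"
  proof -
    have fin: "transport_cost2 \<mu> std_gaussian \<noteq> \<infinity>"
      using c(2) by (auto simp: top_unique)
    then have "(wasserstein2 \<mu> std_gaussian)\<^sup>2 = ereal (enn2real (transport_cost2 \<mu> std_gaussian))"
      by (simp add: wasserstein2_def)
    also have "\<dots> \<le> ereal c"
      using enn2real_mono[OF c(2)] c(1) by simp
    finally show ?thesis .
  qed
  then have "ereal (2 * D - c) \<le> 2 * ereal D - (wasserstein2 \<mu> std_gaussian)\<^sup>2"
    using ereal_minus_mono[of "ereal (2 * D)" "ereal (2 * D)"] by fastforce
  then have "ereal (2 * D - c) \<le> talagrand_deficit \<mu>"
    by (simp add: talagrand_deficit_def D)
  moreover have "min ((relative_entropy \<mu> std_gaussian)\<^sup>2 / ereal (6 * real CARD('n)))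
               (relative_entropy \<mu> std_gaussian / 4) = ereal (min (D\<^sup>2 / (6 * d)) (D / 4))"
  proof -
    have "(ereal D)\<^sup>2 / ereal (6 * real CARD('n)) = ereal (D\<^sup>2 / (6 * d))"
      by (simp add: d_def)
    moreover have "ereal D / 4 = ereal (D / 4)"
      using ereal_divide[of D 4] by simp
    ultimately show ?thesis
      unfolding D by (simp only: ereal_min)
  qed
  moreover have "ereal (min (D\<^sup>2 / (6 * d)) (D / 4)) \<le> ereal (2 * D - c)"
    using main by (simp only: ereal_less_eq)
  ultimately show ?thesis
    by (simp only:)
qed

end
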